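(* Let $n\in\mathbb N$, $\alpha\in(0,1)$, and let $\psi_n:\mathbb R^{3n}\to\{0,1\}$ be any (measurable) test of the hypothesis that $\mathbf X$ does not Granger-cause $\mathbf Y$ with respect to $\mathbf Z$. If $\psi_n$ has level $\alpha$ uniformly over $\mathcal P_0^G$, then it has no power exceeding $\alpha$ against any alternative in $\mathcal A_0$; that is, $$\sup_{Q\in\mathcal P_0^G}Q(\psi_n=1)\le\alpha\quad\implies\quad\sup_{P\in\mathcal A_0}P(\psi_n=1)\le\alpha.$$
   Context: All processes $(\mathbf X,\mathbf Y,\mathbf Z)=((X_t,Y_t,Z_t),t\in\mathbb Z)$ here have real-valued components. $P(\psi_n=1)$ denotes the rejection probability of $\psi_n((X_1,Y_1,Z_1),\dots,(X_n,Y_n,Z_n))$ when the process has law $P$. $\Xi_0$ is the class of laws of strictly stationary processes $(\mathbf X,\mathbf Y,\mathbf Z)$ such that $Y_t=h_Y(X_{t-1},Y_{t-1},Z_{t-1},\varepsilon^Y_t)$ for all $t\in\mathbb Z$, for a measurable $h_Y$ and noise variables with $\varepsilon^Y_t$ independent of $\sigma(X_s,Y_s,Z_s:s<t)$ for all $t$, and such that all variables are absolutely continuous with respect to Lebesgue measure (finite-dimensional distributions of the process are absolutely continuous). Granger causality: with $\mathrm{past}(t)=(t,t-1,\dots)$ and $\mathcal C_t^{-\mathbf X}=\sigma(\mathbf Y_{\mathrm{past}(t)},\mathbf Z_{\mathrm{past}(t)})$, $\mathbf X$ Granger-causes $\mathbf Y$ with respect to $\mathbf Z$ if for some $t\in\mathbb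 Z$, $Y_{t+1}$ is not conditionally independent of $\mathbf X_{\mathrm{past}(t)}$ given $\mathcal C_t^{-\mathbf X}$. $\mathcal P_0^G=\{P\in\Xi_0:\mathbf X\text{ does not Granger-cause }\mathbf Y\text{ with respect to }\mathbf Z\}$. $\mathcal A_0$ is the subclass of $\Xi_0$ of processes generated, for some mutually independent i.i.d. continuous innovation sequences $(\varepsilon^X_t)$, $(\varepsilon^Y_t)$, $(\varepsilon^Z_t)$ and some measurable $f:\mathbb R^3\to\mathbb R$, as $Z_t=\varepsilon^Z_t$, $X_t=\varepsilon^X_t$, $Y_t=f(X_{t-1},Z_{t-1},\varepsilon^Y_t)$, and for which $\mathbf X$ Granger-causes $\mathbf Y$ with respect to $\mathbf Z$. *)

theory Defs
  imports "HOL-Probability.Probability"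
begin

type_synonym obs = "real \<times> real \<times> real"

definition path_space :: "(int \<Rightarrow> obs) measure" where
  "path_space = PiM UNIV (\<lambda>_. borel)"

definition cX :: "int \<Rightarrow> (int \<Rightarrow> obs) \<Rightarrow> real" where "cX t \<omega> = fst (\<omega> t)"
definition cY :: "int \<Rightarrow> (int \<Rightarrow> obs) \<Rightarrow> real" where "cY t \<omega> = fst (snd (\<omega> t))"
definition cZ :: "int \<Rightarrow> (int \<Rightarrow> obs) \<Rightarrow> real" where "cZ t \<omega> = snd (snd (\<omega> t))"

definition law ::
  "'w measure \<Rightarrow> (int \<Rightarrow> 'w \<Rightarrow> real) \<Rightarrow> (int \<Rightarrow> 'w \<Rightarrow> real) \<Rightarrow> (int \<Rightarrow> 'w \<Rightarrow> real) \<Rightarrow> (int \<Rightarrow> obs) measure" where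
  "law M X Y Z = distr M path_space (\<lambda>\<omega> t. (X t \<omega>, Y t \<omega>, Z t \<omega>))"

definition strictly_stationary :: "(int \<Rightarrow> obs) measure \<Rightarrow> bool" where
  "strictly_stationary P \<longleftrightarrow> (\<forall>k. distr P path_space (\<lambda>\<omega> t. \<omega> (t + k)) = P)"

definition fdd_absolutely_continuous :: "(int \<Rightarrow> obs) measure \<Rightarrow> bool" where
  "fdd_absolutely_continuous P \<longleftrightarrow>
     (\<forall>J. finite J \<longrightarrow>
       absolutely_continuous (PiM J (\<lambda>_. lborel)) (distr P (PiM J (\<lambda>_. lborel)) (\<lambda>\<omega>. restrict \<omega> J)))"

definition sigma_vars ::
  "'w measure \<Rightarrow> (int \<Rightarrow> 'w \<Rightarrow> 'b::topological_space) \<Rightarrow> int set \<Rightarrow> 'w measure" where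
  "sigma_vars M V I = sigma (space M) {V s -` B \<inter> space M | s B. s \<in> I \<and> B \<in> sets borel}"

definition cond_indep_given :: "'w measure \<Rightarrow> 'w measure \<Rightarrow> 'w set set \<Rightarrow> 'w set set \<Rightarrow> bool" where
  "cond_indep_given M F \<A> \<B> \<longleftrightarrow>
     (\<forall>a\<in>\<A>. \<forall>b\<in>\<B>. AE \<omega> in M.
        real_cond_exp M F (indicator (a \<inter> b)) \<omega>
          = real_cond_exp M F (indicator a) \<omega> * real_cond_exp M F (indicator b) \<omega>)"

definition granger_causes ::
  "'w measure \<Rightarrow> (int \<Rightarrow> 'w \<Rightarrow> real) \<Rightarrow> (int \<Rightarrow> 'w \<Rightarrow> real) \<Rightarrow> (int \<Rightarrow> 'w \<Rightarrow> real) \<Rightarrow> bool" where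
  "granger_causes M X Y Z \<longleftrightarrow>
     (\<exists>t. \<not> cond_indep_given M (sigma_vars M (\<lambda>s \<omega>. (Y s \<omega>, Z s \<omega>)) {..t})
              (sets (sigma_vars M Y {t + 1})) (sets (sigma_vars M X {..t})))"

text \<open>
  Whether a law admits a representation in terms of noise variables depends only on the joint law of
  process and noise. Four real coordinates per time point carry \<open>(X, Y, Z, \<epsilon>\<^sup>Y)\<close>, and also
  \<open>(Y, \<epsilon>\<^sup>X, \<epsilon>\<^sup>Y, \<epsilon>\<^sup>Z)\<close>, so probability measures on the following type (with arbitrary
  sigma-algebra) realise every such joint law; quantifying over them loses no generality.
\<close>

type_synonym sample = "int \<Rightarrow> real \<times> real \<times> real \<times> real"

definition Y_equation ::
  "'w measure \<Rightarrow> (int \<Rightarrow> 'w \<Rightarrow> real) \<Rightarrow> (int \<Rightarrow> 'w \<Rightarrow> real) \<Rightarrow> (int \<Rightarrow> 'w \<Rightarrow> real)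
    \<Rightarrow> (real \<times> real \<times> real \<times> real \<Rightarrow> real) \<Rightarrow> (int \<Rightarrow> 'w \<Rightarrow> real) \<Rightarrow> bool" where
  "Y_equation M X Y Z h \<epsilon> \<longleftrightarrow>
     h \<in> borel_measurable borel \<and>
     (\<forall>t. \<epsilon> t \<in> borel_measurable M \<and>
        prob_space.indep_set M (sets (sigma_vars M \<epsilon> {t}))
          (sets (sigma_vars M (\<lambda>s \<omega>. (X s \<omega>, Y s \<omega>, Z s \<omega>)) {..<t})) \<and>
        (AE \<omega> in M. Y t \<omega> = h (X (t - 1) \<omega>, Y (t - 1) \<omega>, Z (t - 1) \<omega>, \<epsilon> t \<omega>)))"

definition \<Xi>0 :: "(int \<Rightarrow> obs) measure set" where
  "\<Xi>0 = {P. strictly_stationary P \<and> fdd_absolutely_continuous P \<and>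
     (\<exists>(M :: sample measure) X Y Z h \<epsilon>.
        prob_space M \<and>
        (\<forall>t. X t \<in> borel_measurable M \<and> Y t \<in> borel_measurable M \<and> Z t \<in> borel_measurable M) \<and>
        P = law M X Y Z \<and> Y_equation M X Y Z h \<epsilon>)}"

definition P0G :: "(int \<Rightarrow> obs) measure set" where
  "P0G = {P \<in> \<Xi>0. \<not> granger_causes P cX cY cZ}"

text \<open>``Continuous'' is read as: the common distribution has no atoms.\<close>

definition iid_continuous :: "'w measure \<Rightarrow> (int \<Rightarrow> 'w \<Rightarrow> real) \<Rightarrow> bool" where
  "iid_continuous M \<epsilon> \<longleftrightarrow>
     prob_space.indep_vars M (\<lambda>_. borel) \<epsilon> UNIV \<and>
     (\<forall>s t. distr M borel (\<epsilon> s) = distr M borel (\<epsilon> t)) \<and>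
     (\<forall>t x. emeasure M {\<omega> \<in> space M. \<epsilon> t \<omega> = x} = 0)"

definition mutually_independent_sequences :: "'w measure \<Rightarrow> (int \<Rightarrow> 'w \<Rightarrow> real) list \<Rightarrow> bool" where
  "mutually_independent_sequences M es \<longleftrightarrow>
     prob_space.indep_vars M (\<lambda>_. PiM UNIV (\<lambda>_. borel)) (\<lambda>i \<omega> t. (es ! i) t \<omega>) {..<length es}"

definition A0 :: "(int \<Rightarrow> obs) measure set" where
  "A0 = {P \<in> \<Xi>0. granger_causes P cX cY cZ \<and>
     (\<exists>(M :: sample measure) X Y Z \<epsilon>X \<epsilon>Y \<epsilon>Z f.
        prob_space M \<and>
        (\<forall>t. X t \<in> borel_measurable M \<and> Y t \<in> borel_measurable M \<and> Z t \<in> borel_measurable M) \<and>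
        P = law M X Y Z \<and>
        iid_continuous M \<epsilon>X \<and> iid_continuous M \<epsilon>Y \<and> iid_continuous M \<epsilon>Z \<and>
        mutually_independent_sequences M [\<epsilon>X, \<epsilon>Y, \<epsilon>Z] \<and>
        f \<in> borel_measurable (borel :: (real \<times> real \<times> real) measure) \<and>
        (\<forall>t. AE \<omega> in M. Z t \<omega> = \<epsilon>Z t \<omega> \<and> X t \<omega> = \<epsilon>X t \<omega> \<and>
           Y t \<omega> = f (X (t - 1) \<omega>, Z (t - 1) \<omega>, \<epsilon>Y t \<omega>)))}"

text \<open>
  A sample of size \<open>n\<close> is a function on the time points \<open>1, \<dots>, n\<close>, as an element of a product space
  undefined elsewhere.
\<close>

definition is_test :: "nat \<Rightarrow> ((int \<Rightarrow> obs) \<Rightarrow> nat) \<Rightarrow> bool" where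
  "is_test n \<psi> \<longleftrightarrow> \<psi> \<in> PiM {1..int n} (\<lambda>_. borel) \<rightarrow>\<^sub>M count_space {0, 1}"

definition rejection_prob :: "nat \<Rightarrow> ((int \<Rightarrow> obs) \<Rightarrow> nat) \<Rightarrow> (int \<Rightarrow> obs) measure \<Rightarrow> ennreal" where
  "rejection_prob n \<psi> P = emeasure P {\<omega> \<in> space P. \<psi> (restrict \<omega> {1..int n}) = 1}"

end

theory Submission
  imports Defs
begin

text \<open>
  Under an alternative in \<open>A0\<close> the triples \<open>(X\<^sub>t, \<epsilon>\<^sup>Y\<^sub>t\<^sub>+\<^sub>1, Z\<^sub>t)\<close> are i.i.d. with independent
  coordinates. Cut the line into cells of length \<open>1/k\<close> and attach to every cell \<open>c\<close> constants
  \<open>x\<^sub>c, e\<^sub>c\<close>. The process with \<open>Z\<close> i.i.d., \<open>X\<^sub>t\<close> a smoothed copy of \<open>x\<^sub>c\<close> and \<open>Y\<^sub>t\<^sub>+\<^sub>1\<close> a smoothed copy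
  of \<open>f(x\<^sub>c, Z\<^sub>t, e\<^sub>c)\<close>, where \<open>c\<close> is the cell of \<open>Z\<^sub>t\<close>, belongs to the null: all dependence of
  \<open>Y\<^sub>t\<^sub>+\<^sub>1\<close> on the past goes through \<open>Z\<^sub>t\<close>. Now draw the constants at random, i.i.d. with the laws of
  \<open>\<epsilon>\<^sup>X\<close> and \<open>\<epsilon>\<^sup>Y\<close>. As long as no two of the finitely many relevant \<open>Z\<^sub>t\<close> share a cell, the mixture of
  the null laws is the law of the smoothed alternative, and the probability of a collision tends to
  0 as \<open>k\<close> grows. So the smoothed alternative has rejection probability at most \<open>\<alpha>\<close>. Since the
  finite-dimensional law of the alternative is absolutely continuous, its translates converge on
  every measurable set, which removes the smoothing.
\<close>

section \<open>Removing a smoothing\<close>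

text \<open>The smoothing is forced by \<open>fdd_absolutely_continuous\<close>: with frozen
  constants, \<open>X t\<close> and \<open>Y (t + 1)\<close> would be functions of
  \<open>Z t\<close>, so the law would be singular and lie outside \<open>\<Xi>0\<close>. Adding
  \<delta> times independent uniform noise to \<open>X\<close> and \<open>Y\<close> restores
  densities, while \<open>Z\<close> keeps its own. The noise is added outside \<open>f\<close>,
  which still reads the unsmoothed \<open>X\<close>; hence smoothing the alternative means
  translating its sample vector by an independent small displacement.

  The constants are averaged with the \<open>Z\<close> path held fixed: distinct cells pick distinct
  members of i.i.d. families, so the picked values have the joint law of true innovations. The
  mixture itself need not belong to the null; the level bound reaches it by integrating over the
  constants.

  The limits come in the order \<open>k\<close> to infinity at fixed \<delta>, then \<delta> to 0.
  The second one is the obstacle: the rejection region is merely measurable, so weak convergence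
  would not suffice, and convergence of translates has to be proved for every measurable
  set.\<close>

lemma Int_stable_PiE_convex_open:
  "Int_stable {Pi\<^sub>E (J :: 'a set) U | U. \<forall>j. convex (U j) \<and> open (U j :: 'b::euclidean_space set)}"
proof (rule Int_stableI)
  fix A B :: "('a \<Rightarrow> 'b) set" assume "A \<in> {Pi\<^sub>E J U | U. \<forall>j. convex (U j) \<and> open (U j :: 'b set)}"
    and "B \<in> {Pi\<^sub>E J U | U. \<forall>j. convex (U j) \<and> open (U j)}"
  then obtain U V where UV: "A = Pi\<^sub>E J U" "B = Pi\<^sub>E J V" "\<forall>j. convex (U j) \<and> open (U j)"
    "\<forall>j. convex (V j) \<and> open (V j)" by blast
  then have "A \<inter> B = Pi\<^sub>E J (\<lambda>j. U j \<inter> V j)" by (auto simp: PiE_Int)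
  with UV show "A \<inter> B \<in> {Pi\<^sub>E J U | U. \<forall>j. convex (U j) \<and> open (U j)}"
    by (auto intro!: exI[of _ "\<lambda>j. U j \<inter> V j"] convex_Int open_Int)
qed

text \<open>Translates are easy to control on products of convex open sets, because convex sets have
  Lebesgue-null frontiers. Admitting all convex open sets instead of boxes includes
  \<open>UNIV\<close> as a factor, so a box in a single coordinate is already a generator.\<close>

lemma sets_PiM_lborel_convex_open:
  assumes "finite J"
  shows "sets (PiM J (\<lambda>_. lborel :: 'b::euclidean_space measure)) =
    sigma_sets (PiE J (\<lambda>_. UNIV)) {Pi\<^sub>E J U | U. \<forall>j. convex (U j) \<and> open (U j :: 'b set)}"
    (is "_ = sigma_sets ?\<Omega> ?G")
proof
  have G: "?G \<subseteq> Pow ?\<Omega>" by (auto simp: PiE_iff)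
  interpret S: sigma_algebra ?\<Omega> "sigma_sets ?\<Omega> ?G"
    using G by (rule sigma_algebra_sigma_sets)
  have "{f \<in> ?\<Omega>. f i \<in> A} \<in> sigma_sets ?\<Omega> ?G" if i: "i \<in> J" and A: "A \<in> sets borel" for i and A :: "'b set"
  proof -
    have "A \<in> sigma_sets UNIV (range (\<lambda>(a, b). box a b))"
      using A by (subst (asm) borel_eq_box) (auto simp: sets_measure_of)
    then show ?thesis
    proof induction
      case (Basic a)
      then obtain l u where a: "a = box l u" by auto
      have "{f \<in> ?\<Omega>. f i \<in> a} = Pi\<^sub>E J (\<lambda>j. if j = i then a else UNIV)"
        using i by (auto simp: PiE_iff extensional_def split: if_splits)
      moreover have "Pi\<^sub>E J (\<lambda>j. if j = i then a else UNIV) \<in> ?G"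
        using a by (auto intro!: exI[of _ "\<lambda>j. if j = i then a else UNIV"] convex_box open_box)
      ultimately show ?case by (metis (no_types, lifting) sigma_sets.Basic)
    next
      case Empty
      show ?case by (auto intro: sigma_sets.Empty)
    next
      case (Compl a)
      have "{f \<in> ?\<Omega>. f i \<in> UNIV - a} = ?\<Omega> - {f \<in> ?\<Omega>. f i \<in> a}" by auto
      with Compl show ?case by (metis (no_types, lifting) sigma_sets.Compl)
    next
      case (Union a)
      have "{f \<in> ?\<Omega>. f i \<in> \<Union> (range a)} = (\<Union>n. {f \<in> ?\<Omega>. f i \<in> a n})" by auto
      with Union show ?case by (metis (no_types, lifting) sigma_sets.Union)
    qed
  qed
  then show "sets (PiM J (\<lambda>_. lborel :: 'b measure)) \<subseteq> sigma_sets ?\<Omega> ?G"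
    unfolding sets_PiM_single space_lborel space_borel sets_lborel by (intro S.sigma_sets_subset) auto
  show "sigma_sets ?\<Omega> ?G \<subseteq> sets (PiM J (\<lambda>_. lborel :: 'b measure))"
  proof -
    have "?G \<subseteq> sets (PiM J (\<lambda>_. lborel :: 'b measure))"
      using assms by (auto intro!: sets_PiM_I_finite borel_open)
    from sets.sigma_sets_subset[OF this] show ?thesis by (simp add: space_PiM)
  qed
qed

text \<open>Invariance of the reference measure is what lets one threshold of absolute continuity
  serve all translates at once.\<close>

lemma distr_PiM_lborel_translation:
  fixes h :: "'i \<Rightarrow> 'b::euclidean_space"
  assumes J: "finite J"
  shows "distr (PiM J (\<lambda>_. lborel)) (PiM J (\<lambda>_. lborel)) (\<lambda>w. \<lambda>j\<in>J. w j + h j) = PiM J (\<lambda>_. lborel)"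
proof -
  interpret product_sigma_finite "\<lambda>_::'i. lborel :: 'b measure" by standard
  show ?thesis
  proof (rule PiM_eqI[OF J])
    fix A :: "'i \<Rightarrow> 'b set" assume A: "\<And>i. i \<in> J \<Longrightarrow> A i \<in> sets lborel"
    have [measurable]: "(\<lambda>x. x + c) \<in> lborel \<rightarrow>\<^sub>M lborel" for c :: 'b by simp
    have *: "(\<lambda>x. x + h i) -` A i \<in> sets lborel" if "i \<in> J" for i
      using measurable_sets[of "\<lambda>x. x + h i" lborel lborel, OF _ A[OF that]] by simp
    have "emeasure (distr (PiM J (\<lambda>_. lborel)) (PiM J (\<lambda>_. lborel)) (\<lambda>w. \<lambda>j\<in>J. w j + h j)) (Pi\<^sub>E J A)
        = emeasure (PiM J (\<lambda>_. lborel)) ((\<lambda>w. \<lambda>j\<in>J. w j + h j) -` (Pi\<^sub>E J A) \<inter> space (PiM J (\<lambda>_. lborel)))"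
      using A J by (intro emeasure_distr) (auto intro!: sets_PiM_I_finite)
    also have "(\<lambda>w. \<lambda>j\<in>J. w j + h j) -` (Pi\<^sub>E J A) \<inter> space (PiM J (\<lambda>_. lborel))
        = Pi\<^sub>E J (\<lambda>j. (\<lambda>x. x + h j) -` A j)"
      by (auto simp: space_PiM PiE_iff)
    also have "emeasure (PiM J (\<lambda>_. lborel)) \<dots> = (\<Prod>j\<in>J. emeasure lborel ((\<lambda>x. x + h j) -` A j))"
      using * by (intro emeasure_PiM J)
    also have "\<dots> = (\<Prod>j\<in>J. emeasure lborel (A j))"
    proof (rule prod.cong[OF refl])
      fix j assume "j \<in> J"
      have "emeasure lborel (A j) = emeasure (distr lborel borel ((+) (h j))) (A j)"
        by (simp add: lborel_distr_plus)
      also have "\<dots> = emeasure lborel ((+) (h j) -` A j)"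
        using A[OF \<open>j \<in> J\<close>] by (subst emeasure_distr) auto
      also have "(+) (h j) -` A j = (\<lambda>x. x + h j) -` A j" by (auto simp: add.commute)
      finally show "emeasure lborel ((\<lambda>x. x + h j) -` A j) = emeasure lborel (A j)" by simp
    qed
    finally show "emeasure (distr (PiM J (\<lambda>_. lborel)) (PiM J (\<lambda>_. lborel)) (\<lambda>w. \<lambda>j\<in>J. w j + h j)) (Pi\<^sub>E J A)
      = (\<Prod>j\<in>J. emeasure lborel (A j))" .
  qed simp
qed

text \<open>If this failed, sets of \<open>L\<close>-measure below \<open>(1/2)^n\<close> and
  \<open>M\<close>-measure at least \<open>e\<close> would, by Borel-Cantelli, have an
  \<open>L\<close>-null limsup that still carries \<open>M\<close>-mass at least
  \<open>e\<close>.\<close>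

lemma absolutely_continuous_uniformly:
  assumes fin: "finite_measure M" and sets: "sets M = sets L" and ac: "absolutely_continuous L M" and e: "0 < (e::real)"
  obtains d :: real where "d > 0" "\<And>A. A \<in> sets L \<Longrightarrow> emeasure L A < ennreal d \<Longrightarrow> measure M A < e"
proof (rule ccontr)
  interpret finite_measure M by fact
  assume "\<not> thesis"
  with that have "\<exists>A\<in>sets L. emeasure L A < ennreal d \<and> measure M A \<ge> e" if "d > 0" for d
    using \<open>d > 0\<close> by (meson not_less)
  then have "\<exists>A. \<forall>n. A n \<in> sets L \<and> emeasure L (A n) < ennreal ((1/2)^n) \<and> measure M (A n) \<ge> e"
    by (intro choice) (metis zero_less_power half_gt_zero_iff zero_less_one)
  then obtain A where A: "\<And>n. A n \<in> sets L" "\<And>n. emeasure L (A n) < ennreal ((1/2)^n)" "\<And>n. measure M (A n) \<ge> e"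
    by blast
  have fin: "emeasure L (A n) < \<infinity>" for n
    using A(2)[of n] by (simp add: less_top order_less_trans)
  have "measure L (A n) \<le> (1/2)^n" for n
    using A(2)[of n] by (simp add: measure_def enn2real_leI)
  then have "summable (\<lambda>n. measure L (A n))"
    by (intro summable_comparison_test[OF _ summable_geometric[of "1/2::real"]]) auto
  with A(1) fin have "limsup A \<in> null_sets L" by (intro borel_cantelli_limsup1)
  with ac have null: "measure M (limsup A) = 0"
    by (auto simp: absolutely_continuous_def null_sets_def measure_def)
  have "(\<lambda>n. measure M (\<Union>m\<in>{n..}. A m)) \<longlonglongrightarrow> measure M (\<Inter>n. \<Union>m\<in>{n..}. A m)"
    using A(1) by (intro finite_Lim_measure_decseq decseq_SucI UN_mono) (auto simp: sets)
  moreover have "e \<le> measure M (\<Union>m\<in>{n..}. A m)" for n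
    using A(1) sets by (intro order_trans[OF A(3)[of n]] finite_measure_mono) auto
  ultimately have "e \<le> measure M (\<Inter>n. \<Union>m\<in>{n..}. A m)"
    by (intro LIMSEQ_le_const) auto
  with null e show False by (simp add: limsup_INF_SUP)
qed

text \<open>A Dynkin-class argument whose hard case is the countable disjoint union: termwise
  convergence suffices once the tails are small uniformly in \<open>k\<close>. Uniform absolute
  continuity with respect to \<open>L\<close> provides this, and \<open>K\<close> confines
  everything to finite \<open>L\<close>-measure so that the tails do shrink. Convergence on
  \<open>K\<close> itself feeds the complement case.\<close>

lemma LIMSEQ_measure_from_Int_stable:
  fixes \<nu> :: "nat \<Rightarrow> 'a measure" and \<mu> :: "'a measure"
  assumes fin: "\<And>k. finite_measure (\<nu> k)" "finite_measure \<mu>"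
    and sets: "\<And>k. sets (\<nu> k) = sets L" "sets \<mu> = sets L"
    and unif: "\<And>e::real. e > 0 \<Longrightarrow> \<exists>d::real>0. \<forall>A\<in>sets L. emeasure L A < ennreal d \<longrightarrow>
      (\<forall>k. measure (\<nu> k) A < e) \<and> measure \<mu> A < e"
    and K: "K \<in> sets L" "emeasure L K < \<infinity>"
    and G: "Int_stable G" "G \<subseteq> Pow (space L)" "sets L = sigma_sets (space L) G"
    and conv: "\<And>A. A \<in> G \<Longrightarrow> (\<lambda>k. measure (\<nu> k) (A \<inter> K)) \<longlonglongrightarrow> measure \<mu> (A \<inter> K)"
      "(\<lambda>k. measure (\<nu> k) K) \<longlonglongrightarrow> measure \<mu> K"
    and B: "B \<in> sets L"
  shows "(\<lambda>k. measure (\<nu> k) (B \<inter> K)) \<longlonglongrightarrow> measure \<mu> (B \<inter> K)"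
proof -
  interpret \<nu>: finite_measure "\<nu> k" for k by fact
  interpret \<mu>: finite_measure \<mu> by fact
  note sets [simp]
  have "B \<in> sigma_sets (space L) G" using B G by simp
  with G(1,2) show ?thesis
  proof (induction rule: sigma_sets_induct_disjoint)
    case (basic A) then show ?case by (rule conv)
  next
    case empty then show ?case by simp
  next
    case (compl A)
    then have A: "A \<in> sets L" by (simp add: G)
    have eq: "(space L - A) \<inter> K = K - A \<inter> K" using sets.sets_into_space[OF K(1)] by auto
    have "measure (\<nu> k) ((space L - A) \<inter> K) = measure (\<nu> k) K - measure (\<nu> k) (A \<inter> K)" for k
      unfolding eq using A K by (intro \<nu>.finite_measure_Diff) auto
    moreover have "measure \<mu> ((space L - A) \<inter> K) = measure \<mu> K - measure \<mu> (A \<inter> K)"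
      unfolding eq using A K by (intro \<mu>.finite_measure_Diff) auto
    ultimately show ?case using tendsto_diff[OF conv(2) compl(2)] by simp
  next
    case (union A)
    then have A [measurable]: "\<And>i. A i \<in> sets L" by (auto simp: G)
    define D where "D m = (\<Union>i\<in>{m..}. A i) \<inter> K" for m
    have [measurable]: "D m \<in> sets L" for m unfolding D_def using A K(1) by auto
    have split: "measure N ((\<Union>i. A i) \<inter> K) = (\<Sum>i<m. measure N (A i \<inter> K)) + measure N (D m)"
      if N: "finite_measure N" "sets N = sets L" for N m
    proof -
      interpret N: finite_measure N by fact
      have un: "(\<Union>i. A i) \<inter> K = (\<Union>i<m. A i \<inter> K) \<union> D m"
        unfolding D_def using not_less by auto
      have "A i \<inter> A j = {}" if "i < m" "m \<le> j" for i j
        using disjoint_family_onD[OF union(1), of i j] that by simp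
      then have "(\<Union>i<m. A i \<inter> K) \<inter> D m = {}"
        unfolding D_def by blast
      then have "measure N ((\<Union>i<m. A i \<inter> K) \<union> D m) = measure N (\<Union>i<m. A i \<inter> K) + measure N (D m)"
        using A K N(2) by (intro N.finite_measure_Union) auto
      also have "measure N (\<Union>i<m. A i \<inter> K) = (\<Sum>i<m. measure N (A i \<inter> K))"
      proof (rule N.finite_measure_finite_Union)
        show "disjoint_family_on (\<lambda>i. A i \<inter> K) {..<m}"
          by (rule disjoint_family_on_bisimulation[OF disjoint_family_on_mono[OF subset_UNIV union(1)]]) blast
        show "(\<lambda>i. A i \<inter> K) ` {..<m} \<subseteq> sets N"
          unfolding N(2) by (intro image_subsetI sets.Int A K)
      qed simp
      finally show ?thesis unfolding un .
    qed
    show ?case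
    proof (rule LIMSEQ_I)
      fix r :: real assume "r > 0"
      then obtain d :: real where d: "d > 0" "\<And>A. A \<in> sets L \<Longrightarrow> emeasure L A < ennreal d \<Longrightarrow>
        (\<forall>k. measure (\<nu> k) A < r / 3) \<and> measure \<mu> A < r / 3"
        using unif[of "r / 3"] by auto
      \<comment> \<open>Continuity from above rests on the finite measure of \<open>K\<close>;
        disjointness makes the tails decrease to the empty set. The resulting \<open>m\<close> does
        not depend on \<open>k\<close>, so only a finite sum is left to converge, and
        \<open>r / 3\<close> pays for that sum and the two tails.\<close>
      have "(\<lambda>m. emeasure L (D m)) \<longlonglongrightarrow> emeasure L (\<Inter>m. D m)"
      proof (rule Lim_emeasure_decseq)
        show "decseq D" unfolding D_def by (intro decseq_SucI Int_mono UN_mono) auto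
        show "emeasure L (D i) \<noteq> \<infinity>" for i
          using K emeasure_mono[of "D i" K L] by (auto simp: D_def top_unique)
      qed auto
      also have "(\<Inter>m. D m) = {}"
      proof -
        have False if x: "x \<in> (\<Inter>m. D m)" for x
        proof -
          from x obtain i where i: "x \<in> A i" unfolding D_def by blast
          from x have "x \<in> D (Suc i)" by blast
          then obtain j where j: "j \<ge> Suc i" "x \<in> A j" unfolding D_def by blast
          then have "A i \<inter> A j = {}" by (intro disjoint_family_onD[OF union(1)]) simp_all
          with i j(2) show False by blast
        qed
        then show ?thesis by auto
      qed
      finally have "eventually (\<lambda>m. emeasure L (D m) < ennreal d) sequentially"
        using d(1) by (intro order_tendstoD(2)) auto
      then obtain m where m: "emeasure L (D m) < ennreal d" by (auto simp: eventually_sequentially)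
      have "(\<lambda>k. \<Sum>i<m. measure (\<nu> k) (A i \<inter> K)) \<longlonglongrightarrow> (\<Sum>i<m. measure \<mu> (A i \<inter> K))"
        by (intro tendsto_sum union)
      from LIMSEQ_D[OF this, of "r / 3"] \<open>r > 0\<close> obtain k0 where
        k0: "\<And>k. k \<ge> k0 \<Longrightarrow> \<bar>(\<Sum>i<m. measure (\<nu> k) (A i \<inter> K)) - (\<Sum>i<m. measure \<mu> (A i \<inter> K))\<bar> < r / 3"
        by auto
      have "\<bar>measure (\<nu> k) ((\<Union>i. A i) \<inter> K) - measure \<mu> ((\<Union>i. A i) \<inter> K)\<bar> < r" if "k \<ge> k0" for k
      proof -
        have "measure (\<nu> k) (D m) < r / 3" "measure \<mu> (D m) < r / 3"
          using d(2)[OF _ m] by simp_all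
        moreover have "measure (\<nu> k) (D m) \<ge> 0" "measure \<mu> (D m) \<ge> 0" by auto
        ultimately show ?thesis
          using k0[OF that] unfolding split[OF fin(1) sets(1), of _ m] split[OF fin(2) sets(2), of m]
          by linarith
      qed
      then show "\<exists>no. \<forall>n\<ge>no. norm (measure (\<nu> n) ((\<Union>i. A i) \<inter> K) - measure \<mu> ((\<Union>i. A i) \<inter> K)) < r"
        by auto
    qed
  qed
qed

lemma AE_PiM_lborel_component:
  assumes J: "finite J" "j \<in> J" and N: "N \<in> null_sets (lborel :: 'b::euclidean_space measure)"
  shows "AE w in PiM J (\<lambda>_. lborel). w j \<notin> N"
proof (rule AE_I[where N = "PiE J (\<lambda>i. if i = j then N else UNIV)"])
  interpret product_sigma_finite "\<lambda>_::'a. lborel :: 'b measure" by standard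
  have "emeasure (PiM J (\<lambda>_. lborel)) (PiE J (\<lambda>i. if i = j then N else UNIV))
      = (\<Prod>i\<in>J. emeasure lborel (if i = j then N else UNIV))"
    using N J by (intro emeasure_PiM) auto
  also have "\<dots> = 0" using J N by (intro prod_zero) auto
  finally show "emeasure (PiM J (\<lambda>_. lborel)) (PiE J (\<lambda>i. if i = j then N else UNIV)) = 0" .
qed (use J N in \<open>auto simp: space_PiM PiE_iff extensional_def intro!: sets_PiM_I_finite\<close>)

text \<open>Off the frontiers the indicators converge pointwise: a point of an open factor stays in
  it under small shifts, and a point outside a closure stays outside. Frontiers of convex sets are
  null, hence invisible to \<mu>, and dominated convergence finishes.\<close>

lemma LIMSEQ_measure_translation_PiE:
  fixes h :: "nat \<Rightarrow> 'i \<Rightarrow> 'b::euclidean_space"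
  assumes \<mu>: "finite_measure \<mu>" "sets \<mu> = sets (PiM J (\<lambda>_. lborel :: 'b measure))"
    and ac: "absolutely_continuous (PiM J (\<lambda>_. lborel)) \<mu>"
    and J: "finite J" and h: "\<And>j. j \<in> J \<Longrightarrow> (\<lambda>k. h k j) \<longlonglongrightarrow> 0"
    and U: "\<And>j. convex (U j) \<and> open (U j)"
  shows "(\<lambda>k. measure \<mu> {w \<in> space \<mu>. (\<lambda>j\<in>J. w j + h k j) \<in> PiE J U}) \<longlonglongrightarrow> measure \<mu> (PiE J U)"
proof -
  interpret finite_measure \<mu> by fact
  note \<mu>(2) [measurable_cong, simp]
  have sp: "space \<mu> = PiE J (\<lambda>_. UNIV)" using sets_eq_imp_space_eq[OF \<mu>(2)] by (simp add: space_PiM)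
  have U' [measurable]: "PiE J U \<in> sets \<mu>" using J U by (auto intro!: sets_PiM_I_finite borel_open)
  have "AE w in PiM J (\<lambda>_. lborel). \<forall>j\<in>J. w j \<notin> frontier (U j)"
  proof (intro AE_finite_allI J AE_PiM_lborel_component)
    show "frontier (U j) \<in> null_sets lborel" for j
      using U[of j] negligible_convex_frontier[of "U j"]
      by (simp add: negligible_iff_null_sets null_sets_completion_iff borel_closed)
  qed auto
  then have ae: "AE w in \<mu>. \<forall>j\<in>J. w j \<notin> frontier (U j)"
    by (rule absolutely_continuous_AE[OF \<mu>(2) ac])
  have lim: "(\<lambda>k. indicator {w \<in> space \<mu>. (\<lambda>j\<in>J. w j + h k j) \<in> PiE J U} w :: real)
      \<longlonglongrightarrow> indicator (PiE J U) w"
    if w: "w \<in> space \<mu>" "\<forall>j\<in>J. w j \<notin> frontier (U j)" for w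
  proof -
    have lim: "(\<lambda>k. w j + h k j) \<longlonglongrightarrow> w j" if "j \<in> J" for j
      using tendsto_add[OF tendsto_const h[OF that], of "w j"] by simp
    show ?thesis
    proof (cases "w \<in> PiE J U")
      case True
      have "\<forall>j\<in>J. eventually (\<lambda>k. w j + h k j \<in> U j) sequentially"
        using True U lim by (auto intro!: topological_tendstoD)
      then have "eventually (\<lambda>k. \<forall>j\<in>J. w j + h k j \<in> U j) sequentially"
        using J by (simp add: eventually_ball_finite)
      then have "eventually (\<lambda>k. indicator (PiE J U) w = (indicator {w \<in> space \<mu>. (\<lambda>j\<in>J. w j + h k j) \<in> PiE J U} w :: real)) sequentially"
        using w True by (auto elim!: eventually_mono)
      then show ?thesis by (rule Lim_transform_eventually[OF tendsto_const])
    next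
      case False
      then obtain j where j: "j \<in> J" "w j \<notin> U j" using w sp by (auto simp: PiE_iff)
      with w have "w j \<in> - closure (U j)" using U[of j] by (auto simp: frontier_def interior_open)
      then have "eventually (\<lambda>k. w j + h k j \<in> - closure (U j)) sequentially"
        by (intro topological_tendstoD[OF lim[OF j(1)]]) auto
      then have "eventually (\<lambda>k. indicator (PiE J U) w = (indicator {w \<in> space \<mu>. (\<lambda>j\<in>J. w j + h k j) \<in> PiE J U} w :: real)) sequentially"
      proof eventually_elim
        case (elim k)
        then have "w j + h k j \<notin> U j" using closure_subset by blast
        then have "(\<lambda>j\<in>J. w j + h k j) \<notin> PiE J U" using j(1) PiE_mem[of "\<lambda>j\<in>J. w j + h k j" J U j] by auto
        with False show ?case by simp
      qed
      then show ?thesis by (rule Lim_transform_eventually[OF tendsto_const])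
    qed
  qed
  have meas [measurable]: "{w \<in> space \<mu>. (\<lambda>j\<in>J. w j + h k j) \<in> PiE J U} \<in> sets \<mu>" for k
    using measurable_sets[of "\<lambda>w. \<lambda>j\<in>J. w j + h k j" \<mu> "PiM J (\<lambda>_. lborel)" "PiE J U"] J U
    by (simp add: vimage_def Int_def conj_commute sets_PiM_I_finite borel_open)
  have "(\<lambda>k. \<integral>w. indicator {w \<in> space \<mu>. (\<lambda>j\<in>J. w j + h k j) \<in> PiE J U} w \<partial>\<mu>)
      \<longlonglongrightarrow> (\<integral>w. indicator (PiE J U) w \<partial>\<mu> :: real)"
  proof (rule integral_dominated_convergence[where w = "\<lambda>_. 1"])
    show "AE w in \<mu>. (\<lambda>k. indicator {w \<in> space \<mu>. (\<lambda>j\<in>J. w j + h k j) \<in> PiE J U} w :: real)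
      \<longlonglongrightarrow> indicator (PiE J U) w"
      using ae AE_space by eventually_elim (rule lim)
    show "AE w in \<mu>. norm (indicator {w \<in> space \<mu>. (\<lambda>j\<in>J. w j + h k j) \<in> PiE J U} w :: real) \<le> 1" for k
      by (simp add: indicator_def)
    show "(\<lambda>w. indicator {w \<in> space \<mu>. (\<lambda>j\<in>J. w j + h k j) \<in> PiE J U} w :: real) \<in> borel_measurable \<mu>" for k
      by (rule borel_measurable_indicator[OF meas])
  qed (use U' in simp_all)
  then show ?thesis
    by (simp only: Bochner_Integration.integral_indicator sets.Int_space_eq2[OF meas] sets.Int_space_eq2[OF U'])
qed

text \<open>A set-by-set form of continuity of translations in L1, obtained without naming a
  density. The bounded box supplies the finite reference measure required by
  \<open>LIMSEQ_measure_from_Int_stable\<close>.\<close>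

lemma LIMSEQ_measure_translation:
  fixes h :: "nat \<Rightarrow> 'i \<Rightarrow> 'b::euclidean_space"
  assumes \<mu>: "finite_measure \<mu>" "sets \<mu> = sets (PiM J (\<lambda>_. lborel :: 'b measure))"
    and ac: "absolutely_continuous (PiM J (\<lambda>_. lborel)) \<mu>"
    and J: "finite J" and h: "\<And>j. j \<in> J \<Longrightarrow> (\<lambda>k. h k j) \<longlonglongrightarrow> 0"
    and B: "B \<in> sets \<mu>"
  shows "(\<lambda>k. measure \<mu> {w \<in> space \<mu>. (\<lambda>j\<in>J. w j + h k j) \<in> B \<inter> PiE J (\<lambda>_. box a b)})
    \<longlonglongrightarrow> measure \<mu> (B \<inter> PiE J (\<lambda>_. box a b))"
proof -
  let ?L = "PiM J (\<lambda>_. lborel :: 'b measure)"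
  define T where "T k = (\<lambda>w. \<lambda>j\<in>J. w j + h k j)" for k
  define \<nu> where "\<nu> k = distr \<mu> ?L (T k)" for k
  define K where "K = PiE J (\<lambda>_. box a b)"
  interpret finite_measure \<mu> by fact
  interpret product_sigma_finite "\<lambda>_::'i. lborel :: 'b measure" by standard
  note \<mu>(2) [measurable_cong, simp]
  have sp: "space \<mu> = space ?L" by (rule sets_eq_imp_space_eq) simp
  have T [measurable]: "T k \<in> ?L \<rightarrow>\<^sub>M ?L" for k unfolding T_def by measurable
  have T' [measurable]: "T k \<in> \<mu> \<rightarrow>\<^sub>M ?L" for k using T[of k] measurable_cong_sets[OF \<mu>(2) refl, of ?L] by auto
  have K: "K \<in> sets ?L" unfolding K_def using J by (auto intro!: sets_PiM_I_finite)
  have \<nu>: "measure (\<nu> k) A = measure \<mu> {w \<in> space \<mu>. T k w \<in> A}" if "A \<in> sets ?L" for A k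
    unfolding \<nu>_def using that by (subst measure_distr[OF T']) (auto simp: vimage_def Int_def conj_commute)
  have G: "(\<lambda>k. measure (\<nu> k) (Pi\<^sub>E J U)) \<longlonglongrightarrow> measure \<mu> (Pi\<^sub>E J U)"
    if U: "\<And>j. convex (U j) \<and> open (U j)" for U
    using LIMSEQ_measure_translation_PiE[OF \<mu> ac J h U] U J
    by (subst \<nu>) (auto simp: T_def intro!: sets_PiM_I_finite borel_open)
  have "(\<lambda>k. measure (\<nu> k) (B \<inter> K)) \<longlonglongrightarrow> measure \<mu> (B \<inter> K)"
  proof (rule LIMSEQ_measure_from_Int_stable[where L = ?L and G = "{Pi\<^sub>E J U | U. \<forall>j. convex (U j) \<and> open (U j)}"])
    show "finite_measure (\<nu> k)" for k unfolding \<nu>_def by (rule finite_measure_distr) simp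
    show "finite_measure \<mu>" by fact
    fix e :: real assume "e > 0"
    from absolutely_continuous_uniformly[OF \<mu> ac this] obtain d where
      d: "d > 0" "\<And>A. A \<in> sets ?L \<Longrightarrow> emeasure ?L A < ennreal d \<Longrightarrow> measure \<mu> A < e" by blast
    \<comment> \<open>The threshold \<open>d\<close> found for \<mu> works for each
      \<open>\<nu> k\<close> too, since the preimage of \<open>A\<close> under the translation
      \<open>T k\<close> has the same Lebesgue measure as \<open>A\<close>.\<close>
    have "measure (\<nu> k) A < e" if A: "A \<in> sets ?L" "emeasure ?L A < ennreal d" for A k
    proof -
      have "emeasure ?L A = emeasure (distr ?L ?L (T k)) A"
        unfolding T_def using distr_PiM_lborel_translation[OF J, of "h k"] by simp
      also have "\<dots> = emeasure ?L {w \<in> space \<mu>. T k w \<in> A}"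
        using A(1) by (subst emeasure_distr[OF T]) (auto simp: sp vimage_def Int_def conj_commute)
      finally have "emeasure ?L {w \<in> space \<mu>. T k w \<in> A} < ennreal d" using A(2) by simp
      then show ?thesis unfolding \<nu>[OF A(1)]
        using A(1) measurable_sets[OF T', of A k]
        by (intro d(2)) (auto simp: vimage_def Int_def conj_commute)
    qed
    with d show "\<exists>d::real>0. \<forall>A\<in>sets ?L. emeasure ?L A < ennreal d \<longrightarrow> (\<forall>k. measure (\<nu> k) A < e) \<and> measure \<mu> A < e"
      by blast
  next
    show "emeasure ?L K < \<infinity>"
      unfolding K_def using J emeasure_bounded_finite[OF bounded_box, of a b]
      by (subst emeasure_PiM) (auto simp: power_less_top_ennreal)
    show "(\<lambda>k. measure (\<nu> k) K) \<longlonglongrightarrow> measure \<mu> K"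
      unfolding K_def by (intro G) (auto simp: convex_box)
    fix A assume "A \<in> {Pi\<^sub>E J U | U. \<forall>j. convex (U j) \<and> open (U j :: 'b set)}"
    then obtain U where U: "A = Pi\<^sub>E J U" "\<forall>j. convex (U j) \<and> open (U j)" by blast
    have "A \<inter> K = Pi\<^sub>E J (\<lambda>j. U j \<inter> box a b)" by (simp add: U K_def PiE_Int)
    then show "(\<lambda>k. measure (\<nu> k) (A \<inter> K)) \<longlonglongrightarrow> measure \<mu> (A \<inter> K)"
      using U(2) by (simp only:) (intro G, auto intro!: convex_Int open_Int simp: convex_box)
  next
    show "Int_stable {Pi\<^sub>E J U | U. \<forall>j. convex (U j) \<and> open (U j :: 'b set)}" by (rule Int_stable_PiE_convex_open)
    show "sets ?L = sigma_sets (space ?L) {Pi\<^sub>E J U | U. \<forall>j. convex (U j) \<and> open (U j :: 'b set)}"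
      using sets_PiM_lborel_convex_open[OF J] by (simp add: space_PiM)
  qed (use B K in \<open>auto simp: \<nu>_def space_PiM PiE_iff\<close>)
  then show ?thesis
    using B K by (subst (asm) \<nu>) (auto simp: T_def K_def)
qed

text \<open>For each fixed displacement field \<open>N r\<close> the shifts scaled by \<delta>
  vanish as \<delta> tends to 0, so translation convergence applies pointwise in \<open>r\<close>
  and passes through the integral over \<open>R\<close>. Boxes \<open>K n\<close> truncate
  \<open>B\<close> first and are exhausted at the end.\<close>

lemma emeasure_le_of_smoothed_le:
  fixes N :: "'r \<Rightarrow> 'i \<Rightarrow> 'b::euclidean_space"
  assumes \<mu>: "prob_space \<mu>" "sets \<mu> = sets (PiM J (\<lambda>_. lborel :: 'b measure))"
    and ac: "absolutely_continuous (PiM J (\<lambda>_. lborel)) \<mu>"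
    and J: "finite J" and R: "prob_space R" and N: "\<And>j. (\<lambda>r. N r j) \<in> borel_measurable R"
    and B: "B \<in> sets \<mu>"
    and le: "\<And>\<delta>. 0 < \<delta> \<Longrightarrow> (\<integral>\<^sup>+r. emeasure \<mu> {w \<in> space \<mu>. (\<lambda>j\<in>J. w j + \<delta> *\<^sub>R N r j) \<in> B} \<partial>R) \<le> \<alpha>"
  shows "emeasure \<mu> B \<le> \<alpha>"
proof -
  let ?L = "PiM J (\<lambda>_. lborel :: 'b measure)"
  interpret \<mu>: prob_space \<mu> by fact
  interpret R: prob_space R by fact
  note \<mu>(2) [measurable_cong, simp]
  note N [measurable]
  have sp: "space \<mu> = PiE J (\<lambda>_. UNIV)" using sets_eq_imp_space_eq[OF \<mu>(2)] by (simp add: space_PiM)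
  define K where "K n = PiE J (\<lambda>_. box (- real n *\<^sub>R One) (real n *\<^sub>R (One::'b)))" for n
  have [measurable]: "K n \<in> sets ?L" for n unfolding K_def using J by (auto intro!: sets_PiM_I_finite)
  have [measurable]: "B \<in> sets ?L" using B by simp
  have bound: "emeasure \<mu> (B \<inter> K n) \<le> \<alpha>" for n
  proof -
    define g where "g k r = {w \<in> space \<mu>. (\<lambda>j\<in>J. w j + inverse (real (Suc k)) *\<^sub>R N r j) \<in> B \<inter> K n}" for k r
    have g_meas: "(\<lambda>r. emeasure \<mu> (g k r)) \<in> borel_measurable R" for k
    proof (rule \<mu>.measurable_emeasure)
      have [measurable]: "(\<lambda>p. N (fst p) j) \<in> borel_measurable (R \<Otimes>\<^sub>M \<mu>)" for j
        using measurable_compose[OF measurable_fst N] .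
      have "(\<lambda>p. \<lambda>j\<in>J. snd p j + inverse (real (Suc k)) *\<^sub>R N (fst p) j) \<in> R \<Otimes>\<^sub>M \<mu> \<rightarrow>\<^sub>M ?L"
        by measurable
      from measurable_sets[OF this, of "B \<inter> K n"]
      show "{p \<in> space (R \<Otimes>\<^sub>M \<mu>). snd p \<in> g k (fst p)} \<in> sets (R \<Otimes>\<^sub>M \<mu>)"
        by (rule back_subst[where P = "\<lambda>A. A \<in> sets (R \<Otimes>\<^sub>M \<mu>)"])
          (auto simp: g_def space_pair_measure)
    qed (auto simp: g_def)
    have "(\<lambda>k. \<integral>\<^sup>+r. emeasure \<mu> (g k r) \<partial>R) \<longlonglongrightarrow> (\<integral>\<^sup>+r. emeasure \<mu> (B \<inter> K n) \<partial>R)"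
    proof (rule nn_integral_dominated_convergence[where w = "\<lambda>_. 1"])
      show "AE r in R. (\<lambda>k. emeasure \<mu> (g k r)) \<longlonglongrightarrow> emeasure \<mu> (B \<inter> K n)"
      proof (rule AE_I2)
        fix r
        have "(\<lambda>k. inverse (real (Suc k)) *\<^sub>R N r j) \<longlonglongrightarrow> 0" for j
          using tendsto_scaleR[OF LIMSEQ_inverse_real_of_nat tendsto_const[of "N r j"]] by simp
        then have "(\<lambda>k. measure \<mu> (g k r)) \<longlonglongrightarrow> measure \<mu> (B \<inter> K n)"
          unfolding g_def K_def
          by (intro LIMSEQ_measure_translation[where h = "\<lambda>k j. inverse (real (Suc k)) *\<^sub>R N r j"]
              \<mu>.finite_measure_axioms \<mu>(2) ac J B)
        then show "(\<lambda>k. emeasure \<mu> (g k r)) \<longlonglongrightarrow> emeasure \<mu> (B \<inter> K n)"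
          unfolding \<mu>.emeasure_eq_measure by (rule tendsto_ennrealI)
      qed
      show "AE r in R. emeasure \<mu> (g k r) \<le> 1" for k by (simp add: \<mu>.emeasure_le_1)
    qed (use g_meas in \<open>auto simp: R.emeasure_space_1\<close>)
    \<comment> \<open>Truncation only shrinks the event, so the hypothesis at the positive scale
      \<open>inverse (real (Suc k))\<close> still bounds it.\<close>
    moreover have "(\<integral>\<^sup>+r. emeasure \<mu> (g k r) \<partial>R) \<le> \<alpha>" for k
    proof (rule order_trans[OF nn_integral_mono le])
      fix r
      have "(\<lambda>w. \<lambda>j\<in>J. w j + inverse (real (Suc k)) *\<^sub>R N r j) \<in> \<mu> \<rightarrow>\<^sub>M ?L" by measurable
      from measurable_sets[OF this, of B]
      show "emeasure \<mu> (g k r) \<le> emeasure \<mu> {w \<in> space \<mu>. (\<lambda>j\<in>J. w j + inverse (real (Suc k)) *\<^sub>R N r j) \<in> B}"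
        by (intro emeasure_mono) (auto simp: g_def vimage_def Int_def conj_commute)
    qed simp
    ultimately show ?thesis
      by (auto intro: LIMSEQ_le_const2 simp: R.emeasure_space_1)
  qed
  have "incseq (\<lambda>n. B \<inter> K n)"
    unfolding K_def by (intro incseq_SucI Int_mono PiE_mono subset_box_imp) auto
  then have "(SUP n. emeasure \<mu> (B \<inter> K n)) = emeasure \<mu> (\<Union>n. B \<inter> K n)"
    by (intro SUP_emeasure_incseq) auto
  also have "(\<Union>n. B \<inter> K n) = B"
  proof -
    have "\<exists>n. w \<in> K n" if "w \<in> B" for w
    proof -
      have w: "w \<in> PiE J (\<lambda>_. UNIV)" using that sets.sets_into_space[OF B] sp by auto
      obtain n :: nat where n: "(\<Sum>j\<in>J. norm (w j)) < real n" using reals_Archimedean2 by blast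
      have "w j \<in> box (- real n *\<^sub>R One) (real n *\<^sub>R One)" if j: "j \<in> J" for j
      proof -
        have "norm (w j) < real n" using n member_le_sum[OF j, of "\<lambda>j. norm (w j)"] J by auto
        then have "- real n < w j \<bullet> i \<and> w j \<bullet> i < real n" if "i \<in> Basis" for i
          using Basis_le_norm[OF that, of "w j"] by linarith
        then show ?thesis by (simp add: mem_box)
      qed
      with w show ?thesis unfolding K_def by (intro exI[of _ n]) (auto simp: PiE_iff)
    qed
    then show ?thesis by blast
  qed
  finally have "emeasure \<mu> B = (SUP n. emeasure \<mu> (B \<inter> K n))" ..
  also have "\<dots> \<le> \<alpha>" using bound by (intro SUP_least)
  finally show ?thesis .
qed

section \<open>Null models that hide their causes\<close>

lemma sets_sigma_vars:
  "sets (sigma_vars M V I) = sigma_sets (space M) {V s -` B \<inter> space M | s B. s \<in> I \<and> B \<in> sets borel}"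
  unfolding sigma_vars_def by (rule sets_measure_of) auto

lemma space_sigma_vars [simp]: "space (sigma_vars M V I) = space M"
  unfolding sigma_vars_def by (rule space_measure_of) auto

lemma subalgebra_sigma_vars:
  assumes "\<And>s. s \<in> I \<Longrightarrow> V s \<in> borel_measurable M"
  shows "subalgebra M (sigma_vars M V I)"
  unfolding subalgebra_def sets_sigma_vars using assms
  by (auto intro!: sets.sigma_sets_subset measurable_sets)

lemma measurable_sigma_vars:
  assumes "s \<in> I"
  shows "V s \<in> borel_measurable (sigma_vars M V I)"
  using assms by (intro measurableI) (auto simp: sets_sigma_vars intro!: sigma_sets.Basic)

text \<open>Each generator is a preimage under \<open>T\<close>, and such preimages form a
  sigma-algebra. This turns an abstract event of a generated sigma-algebra into an event of finitely
  or infinitely many coordinates, where product measures and Fubini can act.\<close>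

lemma sigma_vars_factor:
  assumes T: "T \<in> M \<rightarrow>\<^sub>M N"
    and F: "\<And>s. s \<in> I \<Longrightarrow> F s \<in> borel_measurable N" "\<And>s \<omega>. s \<in> I \<Longrightarrow> \<omega> \<in> space M \<Longrightarrow> V s \<omega> = F s (T \<omega>)"
    and A: "A \<in> sets (sigma_vars M V I)"
  obtains D where "D \<in> sets N" "A = T -` D \<inter> space M"
proof -
  have T': "T \<in> space M \<rightarrow> space N" using T by (auto simp: measurable_space)
  have "V s -` B \<inter> space M = T -` (F s -` B \<inter> space N) \<inter> space M" if "s \<in> I" for s B
    using F(2)[OF that] T' by auto
  then have "V s -` B \<inter> space M \<in> sets (vimage_algebra (space M) T N)" if "s \<in> I" "B \<in> sets borel" for s B
    using that by (auto simp: sets_vimage_algebra2[OF T'] intro!: exI[of _ "F s -` B \<inter> space N"] measurable_sets[OF F(1)])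
  then have "{V s -` B \<inter> space M | s B. s \<in> I \<and> B \<in> sets borel} \<subseteq> sets (vimage_algebra (space M) T N)"
    by blast
  then have "sets (sigma_vars M V I) \<subseteq> sets (vimage_algebra (space M) T N)"
    unfolding sets_sigma_vars using sets.sigma_sets_subset[of _ "vimage_algebra (space M) T N"] by simp
  with A that show thesis unfolding sets_vimage_algebra2[OF T'] by blast
qed

section \<open>Coordinates and strict past of an i.i.d. family\<close>

lemma distr_PiM_restrict:
  assumes "prob_space N"
  shows "distr (PiM UNIV (\<lambda>_. N)) (PiM J (\<lambda>_. N)) (\<lambda>\<omega>. restrict \<omega> J) = PiM J (\<lambda>_. N)"
  using distr_PiM_reindex[of UNIV "\<lambda>_. N" "\<lambda>x. x" J] assms by simp

lemma indep_vars_PiM_coordinates: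
  assumes N: "prob_space N"
  shows "prob_space.indep_vars (PiM UNIV (\<lambda>_::'i. N)) (\<lambda>_. N) (\<lambda>i \<omega>. \<omega> i) UNIV"
proof -
  interpret \<Omega>: prob_space "PiM UNIV (\<lambda>_::'i. N)" by (rule prob_space_PiM) (rule N)
  have "distr (PiM UNIV (\<lambda>_::'i. N)) N (\<lambda>\<omega>. \<omega> i) = N" for i
    by (rule distr_PiM_component) (auto simp: N)
  moreover have "distr (PiM UNIV (\<lambda>_::'i. N)) (PiM UNIV (\<lambda>_. N)) (\<lambda>\<omega>. \<omega>) = PiM UNIV (\<lambda>_. N)"
    by (rule distr_id)
  ultimately show ?thesis
    by (subst \<Omega>.indep_vars_iff_distr_eq_PiM) (auto simp: restrict_UNIV)
qed

lemma indep_var_coordinate_past: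
  fixes m :: "'i::order"
  assumes N: "prob_space N"
  shows "prob_space.indep_var (PiM UNIV (\<lambda>_::'i. N)) (PiM {m} (\<lambda>_. N)) (\<lambda>\<omega>. restrict \<omega> {m})
    (PiM {..<m} (\<lambda>_. N)) (\<lambda>\<omega>. restrict \<omega> {..<m})"
proof -
  interpret \<Omega>: prob_space "PiM UNIV (\<lambda>_::'i. N)" by (rule prob_space_PiM) (rule N)
  show ?thesis
    by (rule \<Omega>.indep_var_restrict[OF indep_vars_PiM_coordinates[OF N]]) auto
qed

text \<open>Grouping independent coordinates yields independence of restricted functions such as
  \<open>restrict \<omega> {m}\<close>; the maps \<open>h\<close> and \<open>k\<close> read off the
  actual values from them.\<close>

lemma (in prob_space) distr_pair_indep_var:
  assumes ind: "indep_var A f B g" and [measurable]: "h \<in> A \<rightarrow>\<^sub>M A'" "k \<in> B \<rightarrow>\<^sub>M B'"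
  shows "distr M (A' \<Otimes>\<^sub>M B') (\<lambda>\<omega>. (h (f \<omega>), k (g \<omega>))) = distr M A' (\<lambda>\<omega>. h (f \<omega>)) \<Otimes>\<^sub>M distr M B' (\<lambda>\<omega>. k (g \<omega>))"
proof -
  have f [measurable]: "f \<in> M \<rightarrow>\<^sub>M A" and g [measurable]: "g \<in> M \<rightarrow>\<^sub>M B"
    and eq: "distr M A f \<Otimes>\<^sub>M distr M B g = distr M (A \<Otimes>\<^sub>M B) (\<lambda>\<omega>. (f \<omega>, g \<omega>))"
    using ind unfolding indep_var_distribution_eq by auto
  interpret K: prob_space "distr M B' (\<lambda>\<omega>. k (g \<omega>))" by (rule prob_space_distr) measurable
  have "distr M A' (\<lambda>\<omega>. h (f \<omega>)) \<Otimes>\<^sub>M distr M B' (\<lambda>\<omega>. k (g \<omega>))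
      = distr (distr M A f) A' h \<Otimes>\<^sub>M distr (distr M B g) B' k"
    by (simp add: distr_distr comp_def)
  also have "\<dots> = distr (distr M A f \<Otimes>\<^sub>M distr M B g) (A' \<Otimes>\<^sub>M B') (\<lambda>(x, y). (h x, k y))"
    by (rule pair_measure_distr) (simp_all add: distr_distr comp_def K.sigma_finite_measure_axioms)
  also have "\<dots> = distr M (A' \<Otimes>\<^sub>M B') (\<lambda>\<omega>. (h (f \<omega>), k (g \<omega>)))"
    unfolding eq by (simp add: distr_distr comp_def)
  finally show ?thesis ..
qed

text \<open>This is the form in which independence of the newest innovation is used below: it
  replaces an integral over all innovations by an iterated one, newest coordinate against strict
  past.\<close>

lemma distr_coordinate_past:
  fixes m :: "'i::order"
  assumes N: "prob_space N"
  shows "distr (PiM UNIV (\<lambda>_::'i. N)) (N \<Otimes>\<^sub>M PiM {..<m} (\<lambda>_. N)) (\<lambda>\<omega>. (\<omega> m, restrict \<omega> {..<m})) =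
    N \<Otimes>\<^sub>M PiM {..<m} (\<lambda>_. N)"
proof -
  interpret \<Omega>: prob_space "PiM UNIV (\<lambda>_::'i. N)" by (rule prob_space_PiM) (rule N)
  have "distr (PiM UNIV (\<lambda>_::'i. N)) N (\<lambda>\<omega>. restrict \<omega> {m} m) = N"
    using distr_PiM_component[of UNIV "\<lambda>_::'i. N" m] N by simp
  moreover have "(\<lambda>w. w m) \<in> PiM {m} (\<lambda>_. N) \<rightarrow>\<^sub>M N" by (rule measurable_component_singleton) simp
  ultimately have "distr (PiM UNIV (\<lambda>_::'i. N)) (N \<Otimes>\<^sub>M PiM {..<m} (\<lambda>_. N)) (\<lambda>\<omega>. (restrict \<omega> {m} m, restrict \<omega> {..<m})) =
      N \<Otimes>\<^sub>M PiM {..<m} (\<lambda>_. N)"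
    by (subst \<Omega>.distr_pair_indep_var[OF indep_var_coordinate_past[OF N, of m],
          where h = "\<lambda>w. w m" and k = "\<lambda>r. r"])
      (simp_all only: distr_PiM_restrict[OF N] measurable_ident_sets[OF refl])
  then show ?thesis by simp
qed

abbreviation unif01 :: "real measure" where "unif01 \<equiv> uniform_measure lborel {0..1}"

lemma prob_space_unif01: "prob_space unif01"
  by (rule prob_space_uniform_measure) auto

text \<open>Lebesgue measure is a multiple of its image under any nonconstant affine map, so the
  exceptional set stays null after the change of variable.\<close>

lemma AE_unif01_affine:
  assumes "AE x in lborel. P (x :: real)" and \<delta>: "\<delta> \<noteq> 0"
  shows "AE u in unif01. P (c + \<delta> * u)"
proof -
  have "AE x in density (distr lborel borel (\<lambda>x. c + \<delta> * x)) (\<lambda>_. \<bar>\<delta>\<bar>). P x"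
    using assms(1) by (subst (asm) lborel_real_affine[OF \<delta>, of c])
  then have "AE x in distr lborel borel (\<lambda>x. c + \<delta> * x). P x"
    using \<delta> by (simp add: AE_density)
  then have "AE u in lborel. P (c + \<delta> * u)" by (rule AE_distrD[rotated]) simp
  then show ?thesis by (intro AE_uniform_measureI) auto
qed

text \<open>Here \<open>a\<close> and \<open>b\<close> are arbitrary functions of the current
  \<open>Z\<close>: they are the centres of \<open>X\<close> at the same time and of
  \<open>Y\<close> one step later. The cells and their constants enter only when the locale is
  instantiated, so nothing in it depends on how the causes are hidden.\<close>

locale hidden_model =
  fixes \<mu> :: "real measure" and a b :: "real \<Rightarrow> real" and \<delta> :: real
  assumes prob_space_\<mu>: "prob_space \<mu>" and sets_\<mu> [measurable_cong]: "sets \<mu> = sets borel"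
    and ac_\<mu>: "absolutely_continuous lborel \<mu>"
    and a_meas [measurable]: "a \<in> borel_measurable borel" and b_meas [measurable]: "b \<in> borel_measurable borel"
    and \<delta>: "0 < \<delta>"
begin

text \<open>The last coordinate of the innovations is idle: it only pads the sample type.\<close>

definition N4 :: "(real \<times> real \<times> real \<times> real) measure" where
  "N4 = \<mu> \<Otimes>\<^sub>M (unif01 \<Otimes>\<^sub>M (unif01 \<Otimes>\<^sub>M unif01))"

definition \<Omega> :: "sample measure" where "\<Omega> = PiM UNIV (\<lambda>_. N4)"

definition X where "X t \<omega> = a (fst (\<omega> t)) + \<delta> * fst (snd (\<omega> t))" for t :: int and \<omega> :: sample
definition Y where "Y t \<omega> = b (fst (\<omega> (t - 1))) + \<delta> * fst (snd (snd (\<omega> t)))" for t :: int and \<omega> :: sample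
definition Z where "Z t \<omega> = fst (\<omega> t)" for t :: int and \<omega> :: sample

definition path :: "sample \<Rightarrow> int \<Rightarrow> obs" where "path \<omega> t = (X t \<omega>, Y t \<omega>, Z t \<omega>)"

definition Q :: "(int \<Rightarrow> obs) measure" where "Q = law \<Omega> X Y Z"

section \<open>Stationarity and absolute continuity of the hidden model\<close>

lemma sets_N4 [measurable_cong]: "sets N4 = sets (borel \<Otimes>\<^sub>M (borel \<Otimes>\<^sub>M (borel \<Otimes>\<^sub>M borel)))"
  unfolding N4_def by (intro sets_pair_measure_cong) (auto simp: sets_\<mu>)

lemma prob_space_N4: "prob_space N4"
proof -
  interpret U: prob_space unif01 by (rule prob_space_unif01)
  interpret \<mu>: prob_space \<mu> by (rule prob_space_\<mu>)
  interpret UU: pair_prob_space unif01 unif01 ..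
  interpret UUU: pair_prob_space unif01 "unif01 \<Otimes>\<^sub>M unif01" ..
  interpret P: pair_prob_space \<mu> "unif01 \<Otimes>\<^sub>M (unif01 \<Otimes>\<^sub>M unif01)" ..
  show ?thesis unfolding N4_def by (rule P.prob_space_axioms)
qed

lemma prob_space_\<Omega>: "prob_space \<Omega>"
  unfolding \<Omega>_def by (rule prob_space_PiM) (rule prob_space_N4)

lemma sets_\<Omega> [measurable_cong]: "sets \<Omega> = sets (PiM UNIV (\<lambda>_. N4))"
  by (simp add: \<Omega>_def)

lemma space_\<Omega> [simp]: "space \<Omega> = UNIV"
  by (simp add: \<Omega>_def space_PiM N4_def space_pair_measure sets_eq_imp_space_eq[OF sets_\<mu>])

lemma X_meas [measurable]: "X t \<in> borel_measurable \<Omega>" unfolding X_def by measurable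
lemma Y_meas [measurable]: "Y t \<in> borel_measurable \<Omega>" unfolding Y_def by measurable
lemma Z_meas [measurable]: "Z t \<in> borel_measurable \<Omega>" unfolding Z_def by measurable

lemma path_meas [measurable]: "path \<in> \<Omega> \<rightarrow>\<^sub>M path_space"
proof -
  have "(\<lambda>\<omega>. path \<omega> t) \<in> borel_measurable \<Omega>" for t unfolding path_def by measurable
  then show ?thesis unfolding path_space_def by (intro measurable_PiM_single') auto
qed

lemma Q_eq: "Q = distr \<Omega> path_space path"
  by (simp add: Q_def law_def path_def[abs_def])

lemma prob_space_Q: "prob_space Q"
  unfolding Q_eq by (rule prob_space.prob_space_distr[OF prob_space_\<Omega> path_meas])

text \<open>The map from innovations to paths commutes with time shifts, and shifts preserve the
  i.i.d. law.\<close>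

lemma stationary_Q: "strictly_stationary Q"
  unfolding strictly_stationary_def
proof
  fix k :: int
  have shift: "distr \<Omega> \<Omega> (\<lambda>\<omega> t. \<omega> (t + k)) = \<Omega>"
    using distr_PiM_reindex[of UNIV "\<lambda>_. N4" "\<lambda>t. t + k" UNIV] prob_space_N4 by (simp add: \<Omega>_def restrict_UNIV)
  have [measurable]: "(\<lambda>\<omega> t. \<omega> (t + k)) \<in> \<Omega> \<rightarrow>\<^sub>M \<Omega>"
    unfolding \<Omega>_def by (intro measurable_PiM_single') (auto intro: measurable_component_singleton simp: space_PiM PiE_iff N4_def space_pair_measure sets_eq_imp_space_eq[OF sets_\<mu>])
  have [measurable]: "(\<lambda>\<omega> t. \<omega> (t + k)) \<in> path_space \<rightarrow>\<^sub>M path_space"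
    unfolding path_space_def by (intro measurable_PiM_single') auto
  have "distr Q path_space (\<lambda>\<omega> t. \<omega> (t + k)) = distr \<Omega> path_space (\<lambda>\<omega>. path (\<lambda>t. \<omega> (t + k)))"
  proof -
    have "path (\<lambda>t. \<omega> (t + k)) = (\<lambda>t. path \<omega> (t + k))" for \<omega>
      by (simp add: path_def X_def Y_def Z_def fun_eq_iff algebra_simps)
    then show ?thesis unfolding Q_eq by (subst distr_distr) (simp_all add: comp_def)
  qed
  also have "\<dots> = distr (distr \<Omega> \<Omega> (\<lambda>\<omega> t. \<omega> (t + k))) path_space path"
    by (subst distr_distr) (auto simp: comp_def)
  also have "\<dots> = Q" unfolding shift Q_eq ..
  finally show "distr Q path_space (\<lambda>\<omega> t. \<omega> (t + k)) = Q" .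
qed

text \<open>Given the first innovation, the smoothing spreads the two observed coordinates over
  intervals of length \<delta>, whatever their centres, and the first innovation has a density
  itself. The constant \<open>c\<close> will be \<open>b\<close> at the previous time, which the
  past determines.\<close>

lemma AE_N4_triple:
  assumes A: "AE p in lborel. P (p :: obs)" and [measurable]: "Measurable.pred borel P"
  shows "AE n in N4. P (a (fst n) + \<delta> * fst (snd n), c + \<delta> * fst (snd (snd n)), fst n)"
proof -
  interpret U: prob_space unif01 by (rule prob_space_unif01)
  interpret \<mu>: prob_space \<mu> by (rule prob_space_\<mu>)
  interpret UU: pair_prob_space unif01 unif01 ..
  interpret UUU: pair_prob_space unif01 "unif01 \<Otimes>\<^sub>M unif01" ..
  interpret P: pair_prob_space \<mu> "unif01 \<Otimes>\<^sub>M (unif01 \<Otimes>\<^sub>M unif01)" ..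
  interpret L3: pair_sigma_finite "lborel :: real measure" "lborel \<Otimes>\<^sub>M lborel :: (real \<times> real) measure" ..
  have P' [measurable]: "Measurable.pred (borel \<Otimes>\<^sub>M (borel \<Otimes>\<^sub>M borel)) P" by (simp add: borel_prod)
  have "AE p in lborel \<Otimes>\<^sub>M (lborel \<Otimes>\<^sub>M lborel). P p" using A unfolding lborel_prod .
  \<comment> \<open>The quantifiers are reordered until \<open>z\<close> is outermost, because the
    centre \<open>a z\<close> of the first coordinate depends on it.\<close>
  then have "AE x in lborel. AE q in lborel \<Otimes>\<^sub>M lborel. P (x, q)"
    by (rule L3.AE_pair)
  then have "AE q in lborel \<Otimes>\<^sub>M lborel. AE x in lborel. P (x, q)"
    by (subst (asm) L3.AE_commute) measurable
  then have "AE q in distr (lborel \<Otimes>\<^sub>M lborel) (lborel \<Otimes>\<^sub>M lborel) (\<lambda>(z, y). (y, z)). AE x in lborel. P (x, q)"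
    by (subst (asm) lborel_pair.distr_pair_swap)
  from AE_distrD[OF _ this] have "AE q in lborel \<Otimes>\<^sub>M lborel. AE x in lborel. P (x, (\<lambda>(z, y). (y, z)) q)"
    by simp
  from lborel_pair.AE_pair[OF this] have "AE z in lborel. AE y in lborel. AE x in lborel. P (x, y, z)"
    by simp
  then have "AE z in \<mu>. AE y in lborel. AE x in lborel. P (x, y, z)"
    by (rule absolutely_continuous_AE[OF _ ac_\<mu>, rotated]) (simp add: sets_\<mu>)
  then have "AE z in \<mu>. AE v in unif01. AE u in unif01. P (a z + \<delta> * u, c + \<delta> * v, z)"
  proof eventually_elim
    case (elim z)
    then have "AE y in lborel. AE u in unif01. P (a z + \<delta> * u, y, z)"
      by eventually_elim (rule AE_unif01_affine, use \<delta> in auto)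
    then show ?case by (rule AE_unif01_affine[where P = "\<lambda>y. AE u in unif01. P (a z + \<delta> * u, y, z)"]) (use \<delta> in auto)
  qed
  then have "AE z in \<mu>. AE u in unif01. AE v in unif01. P (a z + \<delta> * u, c + \<delta> * v, z)"
    by eventually_elim (rule UU.AE_commute[THEN iffD1, rotated], assumption, measurable)
  then have "AE z in \<mu>. AE u in unif01. AE w in unif01 \<Otimes>\<^sub>M unif01. P (a z + \<delta> * u, c + \<delta> * fst w, z)"
  proof eventually_elim
    case (elim z)
    then show ?case
      by eventually_elim (rule UU.AE_pair_measure[rotated], simp, measurable)
  qed
  then have "AE z in \<mu>. AE w in unif01 \<Otimes>\<^sub>M (unif01 \<Otimes>\<^sub>M unif01). P (a z + \<delta> * fst w, c + \<delta> * fst (snd w), z)"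
    by eventually_elim (rule UUU.AE_pair_measure[rotated], simp, measurable)
  then show ?thesis
    unfolding N4_def by (intro P.AE_pair_measure[rotated]) (simp, measurable)
qed

lemma fdd_Q: "fdd_absolutely_continuous Q"
proof -
  interpret \<Omega>: prob_space \<Omega> by (rule prob_space_\<Omega>)
  interpret N4: prob_space N4 by (rule prob_space_N4)
  \<comment> \<open>Times are added in increasing order, so that conditionally on the strict past
    each new triple is absolutely continuous by \<open>AE_N4_triple\<close>.\<close>
  have key: "\<forall>A\<in>null_sets (PiM J (\<lambda>_. lborel)). AE \<omega> in \<Omega>. restrict (path \<omega>) J \<notin> A" if "finite J" for J :: "int set"
    using that
  proof (induction J rule: finite_linorder_max_induct)
    case empty
    show ?case
      by (auto simp: PiM_empty null_sets_count_space)
  next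
    case (insert m J)
    show ?case
    proof
      fix A :: "(int \<Rightarrow> obs) set" assume A: "A \<in> null_sets (PiM (insert m J) (\<lambda>_. lborel))"
      interpret product_sigma_finite "\<lambda>_::int. lborel :: obs measure" by standard
      interpret PJ: prob_space "PiM {..<m} (\<lambda>_. N4)" by (rule prob_space_PiM) (rule prob_space_N4)
      interpret pp: pair_sigma_finite N4 "PiM {..<m} (\<lambda>_. N4)" ..
      have mJ: "m \<notin> J" using insert by auto
      have [measurable]: "A \<in> sets (PiM (insert m J) (\<lambda>_. lborel))" using A by auto
      have upd [measurable]: "(\<lambda>(w, x). w(m := x)) \<in> PiM J (\<lambda>_. lborel) \<Otimes>\<^sub>M (lborel :: obs measure) \<rightarrow>\<^sub>M PiM (insert m J) (\<lambda>_. lborel)"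
        by (rule measurable_add_dim)
      \<comment> \<open>The Lebesgue measure of the section of \<open>A\<close> over
        \<open>w\<close>. It vanishes for almost every \<open>w\<close>, and the induction
        hypothesis carries this over to the path on \<open>J\<close>.\<close>
      define e where "e w = (\<integral>\<^sup>+x. indicator A (w(m := x)) \<partial>(lborel :: obs measure))" for w :: "int \<Rightarrow> obs"
      have e_meas [measurable]: "e \<in> borel_measurable (PiM J (\<lambda>_. lborel))"
        unfolding e_def by measurable
      have "(\<integral>\<^sup>+w. indicator A w \<partial>PiM (insert m J) (\<lambda>_. lborel)) = (\<integral>\<^sup>+w. e w \<partial>PiM J (\<lambda>_. lborel))"
        unfolding e_def using insert mJ by (intro product_nn_integral_insert) auto
      then have "(\<integral>\<^sup>+w. e w \<partial>PiM J (\<lambda>_. lborel)) = 0" using A by auto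
      then have "AE w in PiM J (\<lambda>_. lborel). e w = 0" by (subst (asm) nn_integral_0_iff_AE) auto
      then have "{w \<in> space (PiM J (\<lambda>_. lborel)). e w \<noteq> 0} \<in> null_sets (PiM J (\<lambda>_. lborel))"
        by (subst (asm) AE_iff_null) auto
      with insert have "AE \<omega> in \<Omega>. restrict (path \<omega>) J \<notin> {w \<in> space (PiM J (\<lambda>_. lborel)). e w \<noteq> 0}" by blast
      then have e0: "AE \<omega> in \<Omega>. e (restrict (path \<omega>) J) = 0"
        by eventually_elim (auto simp: space_PiM)
      \<comment> \<open>Both \<open>G\<close> and \<open>H\<close> read the whole past
        \<open>{..<m}\<close> and not merely \<open>J\<close>: the predecessor time that
        \<open>Y\<close> looks at may lie outside \<open>J\<close>.\<close>
      define G where "G r = (\<lambda>j\<in>J. (a (fst (r j)) + \<delta> * fst (snd (r j)),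
         b (fst (r (j - 1))) + \<delta> * fst (snd (snd (r j))), fst (r j)))" for r :: sample
      define H where "H n r = (a (fst n) + \<delta> * fst (snd n), b (fst (r (m - 1))) + \<delta> * fst (snd (snd n)), fst n)"
        for n :: "real \<times> real \<times> real \<times> real" and r :: sample
      have G: "restrict (path \<omega>) J = G (restrict \<omega> {..<m})" for \<omega>
        using insert by (auto simp: G_def path_def X_def Y_def Z_def fun_eq_iff)
      have GH: "restrict (path \<omega>) (insert m J) = (G (restrict \<omega> {..<m}))(m := H (\<omega> m) (restrict \<omega> {..<m}))" for \<omega>
        using mJ by (auto simp: G[symmetric] H_def path_def X_def Y_def Z_def fun_eq_iff)
      have [measurable]: "(\<lambda>r. r j) \<in> PiM {..<m} (\<lambda>_. N4) \<rightarrow>\<^sub>M N4" if "j < m" for j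
        using that by (intro measurable_component_singleton) simp
      have Gm [measurable]: "G \<in> PiM {..<m} (\<lambda>_. N4) \<rightarrow>\<^sub>M PiM J (\<lambda>_. lborel)"
        unfolding G_def using insert(2)
        by (intro measurable_restrict) (auto simp: borel_prod[symmetric] intro!: measurable_Pair)
      have Hm [measurable]: "(\<lambda>(n, r). H n r) \<in> N4 \<Otimes>\<^sub>M PiM {..<m} (\<lambda>_. N4) \<rightarrow>\<^sub>M lborel"
        unfolding H_def by measurable
      have [measurable]: "(\<lambda>\<omega>. restrict \<omega> {..<m}) \<in> \<Omega> \<rightarrow>\<^sub>M PiM {..<m} (\<lambda>_. N4)"
        unfolding \<Omega>_def by (rule measurable_restrict_subset) auto
      have d2: "distr \<Omega> (PiM {..<m} (\<lambda>_. N4)) (\<lambda>\<omega>. restrict \<omega> {..<m}) = PiM {..<m} (\<lambda>_. N4)"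
        unfolding \<Omega>_def by (rule distr_PiM_restrict[OF prob_space_N4])
      have "AE r in distr \<Omega> (PiM {..<m} (\<lambda>_. N4)) (\<lambda>\<omega>. restrict \<omega> {..<m}). e (G r) = 0"
        using e0 by (subst AE_distr_iff) (auto simp: G)
      then have "AE r in PiM {..<m} (\<lambda>_. N4). e (G r) = 0" by (simp only: d2)
      then have "AE r in PiM {..<m} (\<lambda>_. N4). AE n in N4. (G r)(m := H n r) \<notin> A"
        using AE_space
      proof eventually_elim
        case (elim r)
        have "AE x in lborel. indicator A ((G r)(m := x)) = (0::ennreal)"
          using elim measurable_space[OF Gm, of r]
          unfolding e_def by (subst (asm) nn_integral_0_iff_AE) auto
        then have "AE x in lborel. (G r)(m := x) \<notin> A" by eventually_elim (auto simp: indicator_def split: if_splits)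
        then show ?case unfolding H_def
          by (rule AE_N4_triple) (use elim measurable_space[OF Gm, of r] in measurable)
      qed
      then have "AE n in N4. AE r in PiM {..<m} (\<lambda>_. N4). (G r)(m := H n r) \<notin> A"
        by (subst pp.AE_commute) measurable
      then have "AE p in N4 \<Otimes>\<^sub>M PiM {..<m} (\<lambda>_. N4). (G (snd p))(m := H (fst p) (snd p)) \<notin> A"
        by (intro pp.AE_pair_measure) auto
      then have "AE p in distr \<Omega> (N4 \<Otimes>\<^sub>M PiM {..<m} (\<lambda>_. N4)) (\<lambda>\<omega>. (\<omega> m, restrict \<omega> {..<m})). (G (snd p))(m := H (fst p) (snd p)) \<notin> A"
        unfolding \<Omega>_def distr_coordinate_past[OF prob_space_N4] .
      from AE_distrD[OF _ this] show "AE \<omega> in \<Omega>. restrict (path \<omega>) (insert m J) \<notin> A"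
        unfolding GH by (simp add: \<Omega>_def)
    qed
  qed
  show ?thesis
    unfolding fdd_absolutely_continuous_def absolutely_continuous_def
  proof (intro allI impI subsetI)
    fix J :: "int set" and A assume J: "finite J" and A: "A \<in> null_sets (PiM J (\<lambda>_. lborel :: obs measure))"
    have r [measurable]: "(\<lambda>\<omega>. restrict \<omega> J) \<in> path_space \<rightarrow>\<^sub>M PiM J (\<lambda>_. lborel)"
      unfolding path_space_def by measurable
    have "AE \<omega> in \<Omega>. restrict (path \<omega>) J \<notin> A" using key[OF J] A by blast
    then have "AE w in distr \<Omega> (PiM J (\<lambda>_. lborel)) (\<lambda>\<omega>. restrict (path \<omega>) J). w \<notin> A"
      using A by (subst AE_distr_iff) auto
    also have "distr \<Omega> (PiM J (\<lambda>_. lborel)) (\<lambda>\<omega>. restrict (path \<omega>) J) = distr Q (PiM J (\<lambda>_. lborel)) (\<lambda>\<omega>. restrict \<omega> J)"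
      unfolding Q_eq by (subst distr_distr) (auto simp: comp_def)
    finally show "A \<in> null_sets (distr Q (PiM J (\<lambda>_. lborel)) (\<lambda>\<omega>. restrict \<omega> J))"
      using A by (subst AE_iff_null_sets) auto
  qed
qed

text \<open>The innovation that serves as the noise \<open>\<epsilon>\<close> of
  \<open>Y_equation\<close>.\<close>

definition V where "V t \<omega> = fst (snd (snd (\<omega> t)))" for t :: int and \<omega> :: sample

lemma restrict_meas [measurable]: "(\<lambda>\<omega>. restrict \<omega> J) \<in> \<Omega> \<rightarrow>\<^sub>M PiM J (\<lambda>_. N4)"
  unfolding \<Omega>_def by (rule measurable_restrict_subset) auto

text \<open>The path at time \<open>s\<close> as a function of innovations alone. Only the times
  \<open>s\<close> and \<open>s - 1\<close> are consulted, so for \<open>s < t\<close> it can be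
  evaluated on innovations restricted to \<open>{..<t}\<close>.\<close>

definition past where "past s r = (a (fst (r s)) + \<delta> * fst (snd (r s)),
   b (fst (r (s - 1))) + \<delta> * fst (snd (snd (r s))), fst (r s))" for s :: int and r :: sample

lemma past_meas:
  assumes "s < t"
  shows "past s \<in> PiM {..<t} (\<lambda>_. N4) \<rightarrow>\<^sub>M (borel :: obs measure)"
proof -
  have [simp, measurable]: "s \<in> {..<t}" "s - 1 \<in> {..<t}" using assms by auto
  show ?thesis unfolding past_def by measurable
qed

lemma path_eq_past: "s < t \<Longrightarrow> path \<omega> s = past s (restrict \<omega> {..<t})"
  by (simp add: past_def path_def X_def Y_def Z_def)

text \<open>The path before \<open>t\<close> never looks at innovations from time \<open>t\<close>
  on, whereas \<open>V t\<close> is read off the innovation at \<open>t\<close>; both events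
  therefore factor through independent groups of coordinates.\<close>

lemma indep_noise_past:
  "prob_space.indep_set \<Omega> (sets (sigma_vars \<Omega> V {t})) (sets (sigma_vars \<Omega> (\<lambda>s \<omega>. path \<omega> s) {..<t}))"
proof -
  interpret \<Omega>: prob_space \<Omega> by (rule prob_space_\<Omega>)
  have [measurable]: "V s \<in> borel_measurable \<Omega>" for s unfolding V_def by measurable
  have [measurable]: "(\<lambda>\<omega>. path \<omega> s) \<in> borel_measurable \<Omega>" for s unfolding path_def by measurable
  have ind: "\<Omega>.indep_var (PiM {t} (\<lambda>_. N4)) (\<lambda>\<omega>. restrict \<omega> {t}) (PiM {..<t} (\<lambda>_. N4)) (\<lambda>\<omega>. restrict \<omega> {..<t})"
    using indep_var_coordinate_past[OF prob_space_N4, of t] by (simp add: \<Omega>_def)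
  show ?thesis
  proof (rule \<Omega>.indep_setI)
    show "sets (sigma_vars \<Omega> V {t}) \<subseteq> \<Omega>.events"
      using subalgebra_sigma_vars[of "{t}" V \<Omega>] by (auto simp: subalgebra_def)
    show "sets (sigma_vars \<Omega> (\<lambda>s \<omega>. path \<omega> s) {..<t}) \<subseteq> \<Omega>.events"
      using subalgebra_sigma_vars[of "{..<t}" "\<lambda>s \<omega>. path \<omega> s" \<Omega>] by (auto simp: subalgebra_def)
    fix A B assume A: "A \<in> sets (sigma_vars \<Omega> V {t})" and B: "B \<in> sets (sigma_vars \<Omega> (\<lambda>s \<omega>. path \<omega> s) {..<t})"
    obtain D where D: "D \<in> sets (PiM {t} (\<lambda>_. N4))" "A = (\<lambda>\<omega>. restrict \<omega> {t}) -` D \<inter> space \<Omega>"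
      by (rule sigma_vars_factor[OF restrict_meas[of "{t}"] _ _ A, of "\<lambda>_ r. fst (snd (snd (r t)))"])
        (auto simp: V_def)
    obtain E where E: "E \<in> sets (PiM {..<t} (\<lambda>_. N4))" "B = (\<lambda>\<omega>. restrict \<omega> {..<t}) -` E \<inter> space \<Omega>"
      by (rule sigma_vars_factor[OF restrict_meas[of "{..<t}"] _ _ B, of past]) (auto simp: past_meas path_eq_past)
    have "A \<inter> B = (\<lambda>\<omega>. (restrict \<omega> {t}, restrict \<omega> {..<t})) -` (D \<times> E) \<inter> space \<Omega>"
      using D E by auto
    with \<Omega>.indep_varD[OF ind D(1) E(1)] show "\<Omega>.prob (A \<inter> B) = \<Omega>.prob A * \<Omega>.prob B"
      using D E by simp
  qed
qed

lemma Q_in_\<Xi>0: "Q \<in> \<Xi>0"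
proof -
  \<comment> \<open>The cell structure is absorbed into the mechanism: of the previous observation,
    \<open>h\<close> uses the \<open>Z\<close> coordinate alone.\<close>
  define h where "h = (\<lambda>(x :: real, y :: real, z, e). b z + \<delta> * e)"
  have h: "h \<in> borel_measurable (borel :: (real \<times> real \<times> real \<times> real) measure)"
    unfolding h_def borel_prod[symmetric] by measurable
  have V: "V t \<in> borel_measurable \<Omega>" for t unfolding V_def by measurable
  have Y: "Y t \<omega> = h (X (t - 1) \<omega>, Y (t - 1) \<omega>, Z (t - 1) \<omega>, V t \<omega>)" for t \<omega>
    by (simp add: h_def Y_def[of t] Z_def V_def)
  have "Y_equation \<Omega> X Y Z h V"
    unfolding Y_equation_def
    by (intro conjI allI AE_I2 h V indep_noise_past[unfolded path_def]) (rule Y)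
  then show ?thesis
    unfolding \<Xi>0_def using stationary_Q fdd_Q prob_space_\<Omega> X_meas Y_meas Z_meas Q_def by blast
qed

text \<open>The conditional law of \<open>Y (t + 1)\<close> given that \<open>Z t\<close> equals
  \<open>z\<close>, evaluated at \<open>A\<close>; by stationarity it is the same for all
  \<open>t\<close>.\<close>

definition g where "g A z = measure N4 {n \<in> space N4. b z + \<delta> * fst (snd (snd n)) \<in> A}" for A z

lemma g_meas [measurable]: assumes [measurable]: "A \<in> sets borel" shows "g A \<in> borel_measurable borel"
proof -
  interpret N4: prob_space N4 by (rule prob_space_N4)
  show ?thesis unfolding g_def by measurable
qed

section \<open>Conditional law of the next Y given the past\<close>

lemma space_path_space [simp]: "space path_space = UNIV"
  by (simp add: path_space_def space_PiM)

lemma coordinates_path_space [measurable]: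
  "cX s \<in> borel_measurable path_space" "cY s \<in> borel_measurable path_space" "cZ s \<in> borel_measurable path_space"
proof -
  have c: "(\<lambda>\<omega>. \<omega> s) \<in> path_space \<rightarrow>\<^sub>M (borel :: obs measure)" unfolding path_space_def by measurable
  have "(\<lambda>x. fst x) \<in> (borel :: obs measure) \<rightarrow>\<^sub>M borel" "(\<lambda>x. fst (snd x)) \<in> (borel :: obs measure) \<rightarrow>\<^sub>M borel"
    "(\<lambda>x. snd (snd x)) \<in> (borel :: obs measure) \<rightarrow>\<^sub>M borel"
    by (intro borel_measurable_continuous_onI continuous_intros)+
  from this[THEN measurable_compose[OF c]] show "cX s \<in> borel_measurable path_space"
    "cY s \<in> borel_measurable path_space" "cZ s \<in> borel_measurable path_space"
    unfolding cX_def cY_def cZ_def by auto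
qed

text \<open>The innovation at \<open>t + 1\<close> is independent of the past, which reaches
  \<open>Y (t + 1)\<close> only through \<open>Z t\<close>; integrating it out leaves
  \<open>g A\<close>. Since \<open>D\<close> ranges over all past events, the identity says that
  even the full past, including \<open>X\<close>, predicts no better than
  \<open>Z t\<close>.\<close>

lemma measure_next_Y:
  assumes A: "A \<in> sets borel" and D: "D \<in> sets (PiM {..t} (\<lambda>_. borel))"
  shows "measure Q {\<omega>. cY (t + 1) \<omega> \<in> A \<and> restrict \<omega> {..t} \<in> D} =
    (\<integral>\<omega>. g A (cZ t \<omega>) * indicator {\<omega>. restrict \<omega> {..t} \<in> D} \<omega> \<partial>Q)"
proof -
  interpret \<Omega>: prob_space \<Omega> by (rule prob_space_\<Omega>)
  interpret N4: prob_space N4 by (rule prob_space_N4)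
  \<comment> \<open>Innovations strictly before \<open>t + 1\<close> determine the path up to and
    including \<open>t\<close>; the map \<open>K\<close> makes this explicit.\<close>
  define R where "R = PiM {..<t + 1} (\<lambda>_. N4)"
  interpret R: prob_space R unfolding R_def by (rule prob_space_PiM) (rule prob_space_N4)
  interpret NR: pair_prob_space N4 R ..
  define K where "K r = (\<lambda>j\<in>{..t}. past j r)" for r
  have K [measurable]: "K \<in> R \<rightarrow>\<^sub>M PiM {..t} (\<lambda>_. borel)"
    unfolding K_def[abs_def] R_def by (intro measurable_restrict past_meas) auto
  have K_eq: "restrict (path \<omega>) {..t} = K (restrict \<omega> {..<t + 1})" for \<omega>
    using path_eq_past[of _ "t + 1"] by (auto simp: K_def fun_eq_iff)
  define \<phi> where "\<phi> n r = (indicator A (b (fst (r t)) + \<delta> * fst (snd (snd n))) * indicator D (K r) :: real)"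
    for n :: "real \<times> real \<times> real \<times> real" and r :: sample
  have rt [measurable]: "(\<lambda>r. r t) \<in> R \<rightarrow>\<^sub>M N4" unfolding R_def by (rule measurable_component_singleton) simp
  have ft [measurable]: "(\<lambda>r. fst (r t)) \<in> R \<rightarrow>\<^sub>M borel" using measurable_compose[OF rt, of fst borel] by simp
  have \<phi>_meas [measurable]: "(\<lambda>(n, r). \<phi> n r) \<in> borel_measurable (N4 \<Otimes>\<^sub>M R)"
    unfolding \<phi>_def using A D by measurable
  have pr [measurable]: "(\<lambda>\<omega>. restrict \<omega> {..<t + 1}) \<in> \<Omega> \<rightarrow>\<^sub>M R" unfolding R_def by (rule restrict_meas)
  have pm [measurable]: "(\<lambda>\<omega>. \<omega> (t + 1)) \<in> \<Omega> \<rightarrow>\<^sub>M N4" unfolding \<Omega>_def by measurable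
  have [measurable]: "(\<lambda>\<omega>. restrict \<omega> {..t}) \<in> path_space \<rightarrow>\<^sub>M PiM {..t} (\<lambda>_. borel)"
    unfolding path_space_def by (rule measurable_restrict_subset) auto
  have S [measurable]: "{\<omega>. restrict \<omega> {..t} \<in> D} \<in> sets path_space"
    using measurable_sets[of "\<lambda>\<omega>. restrict \<omega> {..t}" path_space "PiM {..t} (\<lambda>_. borel)" D] D by (simp add: vimage_def)
  have S' [measurable]: "{\<omega>. cY (t + 1) \<omega> \<in> A} \<in> sets path_space"
    using measurable_sets[of "cY (t + 1)" path_space borel A] A by (simp add: vimage_def)
  have sets_Q [measurable_cong]: "sets Q = sets path_space" by (simp add: Q_eq)
  have "measure Q {\<omega>. cY (t + 1) \<omega> \<in> A \<and> restrict \<omega> {..t} \<in> D} =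
    (\<integral>\<omega>. indicator ({\<omega>. cY (t + 1) \<omega> \<in> A} \<inter> {\<omega>. restrict \<omega> {..t} \<in> D}) \<omega> \<partial>Q)"
    by (simp add: Q_eq Collect_conj_eq)
  also have "\<dots> = (\<integral>\<omega>. indicator ({\<omega>. cY (t + 1) \<omega> \<in> A} \<inter> {\<omega>. restrict \<omega> {..t} \<in> D}) (path \<omega>) \<partial>\<Omega>)"
    unfolding Q_eq by (rule integral_distr) measurable
  also have "\<dots> = (\<integral>\<omega>. \<phi> (\<omega> (t + 1)) (restrict \<omega> {..<t + 1}) \<partial>\<Omega>)"
    by (intro Bochner_Integration.integral_cong refl)
      (simp add: \<phi>_def K_eq[symmetric] indicator_def cY_def path_def Y_def)
  also have "\<dots> = (\<integral>p. \<phi> (fst p) (snd p) \<partial>distr \<Omega> (N4 \<Otimes>\<^sub>M R) (\<lambda>\<omega>. (\<omega> (t + 1), restrict \<omega> {..<t + 1})))"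
    by (subst integral_distr) auto
  also have "\<dots> = (\<integral>p. \<phi> (fst p) (snd p) \<partial>(N4 \<Otimes>\<^sub>M R))"
    unfolding \<Omega>_def R_def distr_coordinate_past[OF prob_space_N4] ..
  also have "\<dots> = (\<integral>r. \<integral>n. \<phi> n r \<partial>N4 \<partial>R)"
  proof -
    have "integrable (N4 \<Otimes>\<^sub>M R) (\<lambda>(n, r). \<phi> n r)"
    proof (rule NR.P.integrable_const_bound[where B = 1])
      show "AE p in N4 \<Otimes>\<^sub>M R. norm (case p of (n, r) \<Rightarrow> \<phi> n r) \<le> 1"
        by (simp add: \<phi>_def indicator_def case_prod_unfold)
    qed (rule \<phi>_meas)
    from NR.integral_snd[OF this] show ?thesis by (simp add: case_prod_unfold)
  qed
  also have "\<dots> = (\<integral>r. g A (fst (r t)) * indicator D (K r) \<partial>R)"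
  proof (intro Bochner_Integration.integral_cong refl)
    fix r :: sample
    have [measurable]: "{n \<in> space N4. b (fst (r t)) + \<delta> * fst (snd (snd n)) \<in> A} \<in> sets N4" using A by measurable
    have "(\<integral>n. \<phi> n r \<partial>N4) = (\<integral>n. indicator {n \<in> space N4. b (fst (r t)) + \<delta> * fst (snd (snd n)) \<in> A} n * indicator D (K r) \<partial>N4)"
      by (intro Bochner_Integration.integral_cong refl) (simp add: \<phi>_def indicator_def)
    also have "\<dots> = g A (fst (r t)) * indicator D (K r)"
      by (simp add: g_def)
    finally show "(\<integral>n. \<phi> n r \<partial>N4) = g A (fst (r t)) * indicator D (K r)" .
  qed
  also have "\<dots> = (\<integral>r. g A (fst (r t)) * indicator D (K r) \<partial>distr \<Omega> R (\<lambda>\<omega>. restrict \<omega> {..<t + 1}))"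
    unfolding \<Omega>_def R_def distr_PiM_restrict[OF prob_space_N4] ..
  also have "\<dots> = (\<integral>\<omega>. g A (fst (restrict \<omega> {..<t + 1} t)) * indicator D (K (restrict \<omega> {..<t + 1})) \<partial>\<Omega>)"
    by (intro integral_distr borel_measurable_times pr measurable_compose[OF ft g_meas[OF A]]
        measurable_compose[OF K borel_measurable_indicator[OF D]])
  also have "\<dots> = (\<integral>\<omega>. g A (cZ t (path \<omega>)) * indicator {\<omega>. restrict \<omega> {..t} \<in> D} (path \<omega>) \<partial>\<Omega>)"
    by (intro Bochner_Integration.integral_cong refl)
      (simp add: K_eq[symmetric] indicator_def cZ_def path_def Z_def)
  also have "\<dots> = (\<integral>\<omega>. g A (cZ t \<omega>) * indicator {\<omega>. restrict \<omega> {..t} \<in> D} \<omega> \<partial>Q)"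
    unfolding Q_eq
    by (intro integral_distr[symmetric] path_meas borel_measurable_times borel_measurable_indicator S
        measurable_compose[OF _ g_meas[OF A]] coordinates_path_space)
  finally show ?thesis .
qed

text \<open>The conditional probability of an event of \<open>Y (t + 1)\<close> is a function of
  \<open>Z t\<close>, hence measurable for the past of \<open>Y\<close> and \<open>Z\<close>, and
  does not change when the past of \<open>X\<close> is added. It can thus be pulled out of the
  conditional expectation of a joint event.\<close>

lemma not_granger_Q: "\<not> granger_causes Q cX cY cZ"
proof -
  interpret Q: prob_space Q by (rule prob_space_Q)
  have sp: "space Q = UNIV" by (simp add: Q_eq)
  have sets_Q [measurable_cong]: "sets Q = sets path_space" by (simp add: Q_eq)
  have [measurable]: "cX s \<in> borel_measurable Q" "cY s \<in> borel_measurable Q" "cZ s \<in> borel_measurable Q" for s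
    by measurable
  have "cond_indep_given Q (sigma_vars Q (\<lambda>s \<omega>. (cY s \<omega>, cZ s \<omega>)) {..t})
      (sets (sigma_vars Q cY {t + 1})) (sets (sigma_vars Q cX {..t}))" for t
  proof -
    define F where "F = sigma_vars Q (\<lambda>s \<omega>. (cY s \<omega>, cZ s \<omega>)) {..t}"
    have subF: "subalgebra Q F" unfolding F_def by (rule subalgebra_sigma_vars) measurable
    interpret F: finite_measure_subalgebra Q F
      by standard (rule subF)
    have past [measurable]: "(\<lambda>\<omega>. restrict \<omega> {..t}) \<in> Q \<rightarrow>\<^sub>M PiM {..t} (\<lambda>_. borel)"
      unfolding measurable_cong_sets[OF sets_Q refl] path_space_def by (rule measurable_restrict_subset) auto
    have comp: "(\<lambda>r. r s) \<in> PiM {..t} (\<lambda>_. borel) \<rightarrow>\<^sub>M (borel :: obs measure)" if "s \<in> {..t}" for s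
      using that by (rule measurable_component_singleton)
    have "(\<lambda>\<omega>. (cY t \<omega>, cZ t \<omega>)) \<in> borel_measurable F"
      unfolding F_def by (rule measurable_sigma_vars) simp
    from measurable_compose[OF this, of snd borel] have Z_F [measurable]: "cZ t \<in> borel_measurable F"
      by (simp add: borel_prod[symmetric])
    \<comment> \<open>Checked by integrating over \<open>C\<close> in \<open>F\<close>: such a
      \<open>C\<close> is a past event as well, so \<open>measure_next_Y\<close> applies to the
      intersection of \<open>B\<close> and \<open>C\<close>.\<close>
    have key: "AE \<omega> in Q. real_cond_exp Q F (indicator (A \<inter> B)) \<omega> = g A' (cZ t \<omega>) * real_cond_exp Q F (indicator B) \<omega>"
      if A: "A = cY (t + 1) -` A' \<inter> space Q" "A' \<in> sets borel"
        and B: "B = (\<lambda>\<omega>. restrict \<omega> {..t}) -` B' \<inter> space Q" "B' \<in> sets (PiM {..t} (\<lambda>_. borel))"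
      for A A' B B'
    proof (rule F.real_cond_exp_charact)
      have gb: "\<bar>g A' z\<bar> \<le> 1" for z
        unfolding g_def using prob_space.prob_le_1[OF prob_space_N4] by simp
      have [measurable]: "g A' \<in> borel_measurable borel" using A(2) by (rule g_meas)
      have [measurable]: "B \<in> sets Q" unfolding B(1) using B(2) by measurable
      have [measurable]: "A \<in> sets Q" unfolding A(1) using A(2) by measurable
      have zQ [measurable]: "(\<lambda>\<omega>. g A' (cZ t \<omega>)) \<in> borel_measurable Q" by measurable
      have zF: "(\<lambda>\<omega>. g A' (cZ t \<omega>)) \<in> borel_measurable F" by measurable
      show "integrable Q (indicator (A \<inter> B) :: _ \<Rightarrow> real)"
        by (intro Q.integrable_const_bound[where B = 1]) (simp_all add: indicator_def)
      show "integrable Q (\<lambda>\<omega>. g A' (cZ t \<omega>) * real_cond_exp Q F (indicator B) \<omega>)"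
        using gb by (intro F.real_cond_exp_intg(1) zF Q.integrable_const_bound[where B = 1])
          (auto simp: abs_mult indicator_def)
      show "(\<lambda>\<omega>. g A' (cZ t \<omega>) * real_cond_exp Q F (indicator B) \<omega>) \<in> borel_measurable F"
        using zF by measurable
      fix C assume C: "C \<in> sets F"
      then have CQ [measurable]: "C \<in> sets Q" using subF by (auto simp: subalgebra_def)
      obtain C' where C': "C' \<in> sets (PiM {..t} (\<lambda>_. borel))" "C = (\<lambda>\<omega>. restrict \<omega> {..t}) -` C' \<inter> space Q"
        by (rule sigma_vars_factor[OF past _ _ C[unfolded F_def], of "\<lambda>s r. snd (r s)"])
          (auto simp: cY_def cZ_def intro!: measurable_compose[OF comp] simp: borel_prod[symmetric])
      have "(\<integral>\<omega>\<in>C. indicator (A \<inter> B) \<omega> \<partial>Q) = (\<integral>\<omega>. indicator (A \<inter> B \<inter> C) \<omega> \<partial>Q)"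
        unfolding set_lebesgue_integral_def
        by (intro Bochner_Integration.integral_cong refl) (auto simp: indicator_def)
      also have "\<dots> = measure Q {\<omega>. cY (t + 1) \<omega> \<in> A' \<and> restrict \<omega> {..t} \<in> B' \<inter> C'}"
        unfolding A B C' sp by (simp add: sp Collect_conj_eq vimage_def Int_assoc)
      also have "\<dots> = (\<integral>\<omega>. g A' (cZ t \<omega>) * indicator {\<omega>. restrict \<omega> {..t} \<in> B' \<inter> C'} \<omega> \<partial>Q)"
        using A B C' by (intro measure_next_Y) auto
      also have "\<dots> = (\<integral>\<omega>. (indicator C \<omega> * g A' (cZ t \<omega>)) * indicator B \<omega> \<partial>Q)"
        unfolding B C' sp by (intro Bochner_Integration.integral_cong refl) (auto simp: indicator_def)
      also have "\<dots> = (\<integral>\<omega>. (indicator C \<omega> * g A' (cZ t \<omega>)) * real_cond_exp Q F (indicator B) \<omega> \<partial>Q)"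
        using gb C zF by (intro F.real_cond_exp_intg(2)[symmetric] Q.integrable_const_bound[where B = 1])
          (auto simp: abs_mult indicator_def)
      also have "\<dots> = (\<integral>\<omega>\<in>C. g A' (cZ t \<omega>) * real_cond_exp Q F (indicator B) \<omega> \<partial>Q)"
        unfolding set_lebesgue_integral_def by (simp add: mult.assoc)
      finally show "(\<integral>\<omega>\<in>C. indicator (A \<inter> B) \<omega> \<partial>Q) = (\<integral>\<omega>\<in>C. g A' (cZ t \<omega>) * real_cond_exp Q F (indicator B) \<omega> \<partial>Q)" .
    qed
    show ?thesis
      unfolding cond_indep_given_def F_def[symmetric]
    proof (intro ballI)
      fix A B assume A: "A \<in> sets (sigma_vars Q cY {t + 1})" and B: "B \<in> sets (sigma_vars Q cX {..t})"
      obtain A' where A': "A' \<in> sets borel" "A = cY (t + 1) -` A' \<inter> space Q"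
        by (rule sigma_vars_factor[of "cY (t + 1)" Q borel _ "\<lambda>_ y. y", OF _ _ _ A]) auto
      obtain B' where B': "B' \<in> sets (PiM {..t} (\<lambda>_. borel))" "B = (\<lambda>\<omega>. restrict \<omega> {..t}) -` B' \<inter> space Q"
        by (rule sigma_vars_factor[OF past _ _ B, of "\<lambda>s r. fst (r s)"])
          (auto simp: cX_def intro!: measurable_compose[OF comp] simp: borel_prod[symmetric])
      \<comment> \<open>With the whole space as the past event, \<open>key\<close> identifies the
        conditional probability of \<open>A\<close> alone, which is the factor still missing from
        the product formula.\<close>
      have U: "space Q = (\<lambda>\<omega>. restrict \<omega> {..t}) -` (space (PiM {..t} (\<lambda>_. borel :: obs measure))) \<inter> space Q"
        by (auto simp: space_PiM)
      have AU: "A \<inter> space Q = A" using A' by auto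
      have "AE \<omega> in Q. real_cond_exp Q F (indicator (space Q)) \<omega> = indicator (space Q) \<omega>"
      proof (rule F.real_cond_exp_F_meas)
        have "space Q \<in> sets F" using sets.top[of F] by (simp add: F_def)
        then show "(indicator (space Q) :: _ \<Rightarrow> real) \<in> borel_measurable F" by simp
      qed (intro Q.integrable_const_bound[where B = 1], simp_all add: indicator_def)
      with key[OF A'(2,1) B'(2,1)] key[OF A'(2,1) U sets.top] AE_space
      show "AE \<omega> in Q. real_cond_exp Q F (indicator (A \<inter> B)) \<omega> =
          real_cond_exp Q F (indicator A) \<omega> * real_cond_exp Q F (indicator B) \<omega>"
        unfolding AU by eventually_elim simp
    qed
  qed
  then show ?thesis unfolding granger_causes_def by blast
qed

lemma Q_in_P0G: "Q \<in> P0G"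
  using Q_in_\<Xi>0 not_granger_Q by (simp add: P0G_def)

end

section \<open>Collisions of cells\<close>

text \<open>With one family fixed, the cylinder becomes a product of sections, whose probability
  factorises over \<open>j\<close>; independence of the other family then factorises the remaining
  integral. These values determine the law in \<open>distr_PiM_zip\<close>.\<close>

lemma emeasure_PiM_pair_cylinder:
  assumes A: "prob_space A" and B: "prob_space B" and J: "finite J" "J \<subseteq> I"
    and F: "\<And>j. j \<in> J \<Longrightarrow> F j \<in> sets (A \<Otimes>\<^sub>M B)"
  shows "emeasure (PiM I (\<lambda>_. A) \<Otimes>\<^sub>M PiM I (\<lambda>_. B))
      {p \<in> space (PiM I (\<lambda>_. A) \<Otimes>\<^sub>M PiM I (\<lambda>_. B)). \<forall>j\<in>J. (fst p j, snd p j) \<in> F j}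
    = (\<Prod>j\<in>J. emeasure (A \<Otimes>\<^sub>M B) (F j))" (is "emeasure (?PA \<Otimes>\<^sub>M ?PB) ?S = _")
proof -
  interpret A: prob_space A by fact
  interpret B: prob_space B by fact
  interpret PA: product_prob_space "\<lambda>_. A" I by standard
  interpret PB: product_prob_space "\<lambda>_. B" I by standard
  have comp: "(\<lambda>p. (fst p j, snd p j)) \<in> ?PA \<Otimes>\<^sub>M ?PB \<rightarrow>\<^sub>M A \<Otimes>\<^sub>M B" if "j \<in> J" for j
    using that J by (intro measurable_Pair measurable_compose[OF measurable_fst] measurable_compose[OF measurable_snd]
        measurable_component_singleton) auto
  have S: "?S \<in> sets (?PA \<Otimes>\<^sub>M ?PB)"
    using J(1) F measurable_sets[OF comp F]
    by (intro sets.sets_Collect_finite_All) (auto simp: vimage_def Int_def conj_commute)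
  have "emeasure (?PA \<Otimes>\<^sub>M ?PB) ?S = (\<integral>\<^sup>+x. emeasure ?PB (Pair x -` ?S) \<partial>?PA)"
    by (rule PB.P.emeasure_pair_measure_alt[OF S])
  also have "\<dots> = (\<integral>\<^sup>+x. (\<Prod>j\<in>J. emeasure B (Pair (x j) -` F j)) \<partial>?PA)"
  proof (rule nn_integral_cong)
    fix x assume x: "x \<in> space ?PA"
    have eq: "Pair x -` ?S = {y \<in> space ?PB. \<forall>j\<in>J. y j \<in> Pair (x j) -` F j}"
      using x by (auto simp: space_pair_measure)
    show "emeasure ?PB (Pair x -` ?S) = (\<Prod>j\<in>J. emeasure B (Pair (x j) -` F j))"
      unfolding eq using F by (intro PB.emeasure_PiM_Collect[OF J(2,1)] sets_Pair1)
  qed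
  also have "\<dots> = (\<integral>\<^sup>+x. (\<Prod>j\<in>J. emeasure B (Pair (x j) -` F j)) \<partial>PiM J (\<lambda>_. A))"
  proof -
    have [measurable]: "(\<lambda>x. emeasure B (Pair x -` F j)) \<in> borel_measurable A" if "j \<in> J" for j
      using F[OF that] by (rule B.measurable_emeasure_Pair)
    have "(\<lambda>x. \<Prod>j\<in>J. emeasure B (Pair (x j) -` F j)) \<in> borel_measurable (PiM J (\<lambda>_. A))"
      by (intro borel_measurable_prod_ennreal measurable_compose[OF measurable_component_singleton]) auto
    then have "(\<integral>\<^sup>+x. (\<Prod>j\<in>J. emeasure B (Pair (x j) -` F j)) \<partial>distr ?PA (PiM J (\<lambda>_. A)) (\<lambda>x. restrict x J))
        = (\<integral>\<^sup>+x. (\<Prod>j\<in>J. emeasure B (Pair (restrict x J j) -` F j)) \<partial>?PA)"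
      using J by (intro nn_integral_distr measurable_restrict_subset) auto
    then show ?thesis unfolding PA.distr_PiM_restrict_finite[OF J] by simp
  qed
  also have "\<dots> = (\<Prod>j\<in>J. \<integral>\<^sup>+x. emeasure B (Pair x -` F j) \<partial>A)"
    using F by (intro PA.product_nn_integral_prod J B.measurable_emeasure_Pair)
  also have "\<dots> = (\<Prod>j\<in>J. emeasure (A \<Otimes>\<^sub>M B) (F j))"
    using F by (intro prod.cong refl B.emeasure_pair_measure_alt[symmetric])
  finally show ?thesis .
qed

lemma measurable_zip:
  "(\<lambda>(x, y) i. (x i, y i)) \<in> PiM UNIV (\<lambda>_. A) \<Otimes>\<^sub>M PiM UNIV (\<lambda>_. B) \<rightarrow>\<^sub>M PiM UNIV (\<lambda>_. A \<Otimes>\<^sub>M B)"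
  by (intro measurable_PiM_single') (auto simp: space_PiM space_pair_measure PiE_iff case_prod_unfold intro!: measurable_Pair)

text \<open>The hidden model draws \<open>Z\<close> and noise together at each time, while the
  collision argument needs the \<open>Z\<close> sequence as a separate factor. Zipping passes
  between the two pictures.\<close>

lemma distr_PiM_zip:
  assumes A: "prob_space A" and B: "prob_space B"
  shows "distr (PiM UNIV (\<lambda>_. A) \<Otimes>\<^sub>M PiM UNIV (\<lambda>_. B)) (PiM UNIV (\<lambda>_. A \<Otimes>\<^sub>M B)) (\<lambda>(x, y) i. (x i, y i))
    = PiM UNIV (\<lambda>_. A \<Otimes>\<^sub>M B)" (is "distr ?P ?Q ?z = _")
proof -
  interpret A: prob_space A by fact
  interpret B: prob_space B by fact
  interpret AB: pair_prob_space A B ..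
  interpret PP: product_prob_space "\<lambda>_. A \<Otimes>\<^sub>M B" UNIV by standard
  have z [measurable]: "?z \<in> ?P \<rightarrow>\<^sub>M ?Q"
    by (rule measurable_zip)
  show ?thesis
  proof (rule PP.PiM_eq)
    fix J F assume J: "finite J" "J \<subseteq> (UNIV :: 'c set)" and F: "\<And>j. j \<in> J \<Longrightarrow> F j \<in> sets (A \<Otimes>\<^sub>M B)"
    have "?z -` prod_emb UNIV (\<lambda>_. A \<Otimes>\<^sub>M B) J (Pi\<^sub>E J F) \<inter> space ?P = {p \<in> space ?P. \<forall>j\<in>J. (fst p j, snd p j) \<in> F j}"
      by (auto simp: prod_emb_def space_PiM space_pair_measure PiE_iff case_prod_unfold restrict_def extensional_def)
    then show "emeasure (distr ?P ?Q ?z) (prod_emb UNIV (\<lambda>_. A \<Otimes>\<^sub>M B) J (Pi\<^sub>E J F)) = (\<Prod>j\<in>J. emeasure (A \<Otimes>\<^sub>M B) (F j))"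
      using F J emeasure_PiM_pair_cylinder[OF A B J F]
      by (subst emeasure_distr) (auto intro!: sets_PiM_I)
  qed simp
qed

text \<open>Picking distinct members of an i.i.d. family yields an i.i.d. family again. The
  injections will send each time to the cell containing the relevant \<open>Z\<close>, so this is
  where cell constants become genuine innovations.\<close>

lemma nn_integral_PiM_pair_reindex:
  assumes A: "prob_space A" and B: "prob_space B" and inj: "inj_on \<sigma> I" "inj_on \<tau> J"
    and g: "g \<in> borel_measurable (PiM I (\<lambda>_. A) \<Otimes>\<^sub>M PiM J (\<lambda>_. B))"
  shows "(\<integral>\<^sup>+p. g (\<lambda>t\<in>I. fst p (\<sigma> t), \<lambda>t\<in>J. snd p (\<tau> t)) \<partial>(PiM UNIV (\<lambda>_. A) \<Otimes>\<^sub>M PiM UNIV (\<lambda>_. B)))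
    = (\<integral>\<^sup>+p. g p \<partial>(PiM I (\<lambda>_. A) \<Otimes>\<^sub>M PiM J (\<lambda>_. B)))"
proof -
  let ?PA = "PiM UNIV (\<lambda>_. A)" and ?PB = "PiM UNIV (\<lambda>_. B)"
  have s: "(\<lambda>x. \<lambda>t\<in>I. x (\<sigma> t)) \<in> ?PA \<rightarrow>\<^sub>M PiM I (\<lambda>_. A)" and t: "(\<lambda>x. \<lambda>t\<in>J. x (\<tau> t)) \<in> ?PB \<rightarrow>\<^sub>M PiM J (\<lambda>_. B)"
    by (intro measurable_restrict measurable_component_singleton UNIV_I)+
  have dA: "distr ?PA (PiM I (\<lambda>_. A)) (\<lambda>x. \<lambda>t\<in>I. x (\<sigma> t)) = PiM I (\<lambda>_. A)"
    using distr_PiM_reindex[of UNIV "\<lambda>_. A" \<sigma> I] A inj(1) by simp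
  have dB: "distr ?PB (PiM J (\<lambda>_. B)) (\<lambda>x. \<lambda>t\<in>J. x (\<tau> t)) = PiM J (\<lambda>_. B)"
    using distr_PiM_reindex[of UNIV "\<lambda>_. B" \<tau> J] B inj(2) by simp
  interpret PB: prob_space "PiM J (\<lambda>_. B)" by (rule prob_space_PiM) (rule B)
  have "PiM I (\<lambda>_. A) \<Otimes>\<^sub>M PiM J (\<lambda>_. B) = distr (?PA \<Otimes>\<^sub>M ?PB) (PiM I (\<lambda>_. A) \<Otimes>\<^sub>M PiM J (\<lambda>_. B))
      (\<lambda>(x, y). (\<lambda>t\<in>I. x (\<sigma> t), \<lambda>t\<in>J. y (\<tau> t)))"
    using pair_measure_distr[OF s t] unfolding dA dB by (simp add: PB.sigma_finite_measure_axioms)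
  then have "(\<integral>\<^sup>+p. g p \<partial>(PiM I (\<lambda>_. A) \<Otimes>\<^sub>M PiM J (\<lambda>_. B))) =
      (\<integral>\<^sup>+p. g p \<partial>distr (?PA \<Otimes>\<^sub>M ?PB) (PiM I (\<lambda>_. A) \<Otimes>\<^sub>M PiM J (\<lambda>_. B))
      (\<lambda>(x, y). (\<lambda>t\<in>I. x (\<sigma> t), \<lambda>t\<in>J. y (\<tau> t))))" by simp
  also have "\<dots> = (\<integral>\<^sup>+p. g (\<lambda>t\<in>I. fst p (\<sigma> t), \<lambda>t\<in>J. snd p (\<tau> t)) \<partial>(?PA \<Otimes>\<^sub>M ?PB))"
    using s t g by (subst nn_integral_distr) (auto simp: case_prod_unfold)
  finally show ?thesis ..
qed

lemma floor_mult_neq: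
  assumes "1 \<le> real k * \<bar>x - y\<bar>"
  shows "\<lfloor>real k * x\<rfloor> \<noteq> \<lfloor>real k * y\<rfloor>"
proof
  assume eq: "\<lfloor>real k * x\<rfloor> = \<lfloor>real k * y\<rfloor>"
  have "\<bar>real k * x - real k * y\<bar> < 1"
    using floor_correct[of "real k * x"] floor_correct[of "real k * y"] eq by linarith
  moreover have "\<bar>real k * x - real k * y\<bar> = real k * \<bar>x - y\<bar>"
    by (simp add: abs_mult flip: right_diff_distrib)
  ultimately show False using assms by simp
qed

text \<open>Two different coordinates have joint law the square of \<mu>, and an atomless \<mu>
  gives the diagonal mass 0.\<close>

lemma AE_PiM_inj_on:
  assumes \<mu>: "prob_space \<mu>" "sets \<mu> = sets borel" and atomless: "\<And>x :: real. emeasure \<mu> {x} = 0" and I: "finite I"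
  shows "AE z in PiM UNIV (\<lambda>_::'i. \<mu>). inj_on z I"
proof -
  let ?P = "PiM UNIV (\<lambda>_::'i. \<mu>)"
  interpret \<mu>: prob_space \<mu> by fact
  interpret P: prob_space ?P by (rule prob_space_PiM) (rule \<mu>)
  interpret pp: pair_prob_space \<mu> \<mu> ..
  note \<mu>(2) [measurable_cong]
  have "AE z in ?P. z i \<noteq> z j" if "i \<noteq> j" for i j
  proof -
    have ind: "P.indep_var (PiM {i} (\<lambda>_. \<mu>)) (\<lambda>\<omega>. restrict \<omega> {i}) (PiM {j} (\<lambda>_. \<mu>)) (\<lambda>\<omega>. restrict \<omega> {j})"
      by (rule P.indep_var_restrict[OF indep_vars_PiM_coordinates[OF \<mu>(1)]]) (use that in auto)
    have "distr ?P \<mu> (\<lambda>z. restrict z {l} l) = \<mu>" for l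
      using distr_PiM_component[of UNIV "\<lambda>_::'i. \<mu>" l] \<mu>(1) by simp
    moreover have "(\<lambda>w. w l) \<in> PiM {l} (\<lambda>_. \<mu>) \<rightarrow>\<^sub>M \<mu>" for l :: 'i by (rule measurable_component_singleton) simp
    ultimately have "distr ?P (\<mu> \<Otimes>\<^sub>M \<mu>) (\<lambda>z. (restrict z {i} i, restrict z {j} j)) = \<mu> \<Otimes>\<^sub>M \<mu>"
      by (subst P.distr_pair_indep_var[OF ind, where h = "\<lambda>w. w i" and k = "\<lambda>w. w j"]) simp_all
    then have eq: "distr ?P (\<mu> \<Otimes>\<^sub>M \<mu>) (\<lambda>z. (z i, z j)) = \<mu> \<Otimes>\<^sub>M \<mu>" by simp
    have "AE y in \<mu>. x \<noteq> y" for x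
      using atomless[of x] \<mu>(2) by (intro AE_I[of _ _ "{x}"]) auto
    then have "AE p in \<mu> \<Otimes>\<^sub>M \<mu>. fst p \<noteq> snd p"
    proof (intro pp.AE_pair_measure)
      have "fst \<in> borel_measurable (\<mu> \<Otimes>\<^sub>M \<mu>)" "snd \<in> borel_measurable (\<mu> \<Otimes>\<^sub>M \<mu>)"
        using measurable_fst[of \<mu> \<mu>] measurable_snd[of \<mu> \<mu>] measurable_cong_sets[OF refl \<mu>(2)] by blast+
      then show "{p \<in> space (\<mu> \<Otimes>\<^sub>M \<mu>). fst p \<noteq> snd p} \<in> sets (\<mu> \<Otimes>\<^sub>M \<mu>)" by (rule borel_measurable_neq)
    qed simp
    then have "AE p in distr ?P (\<mu> \<Otimes>\<^sub>M \<mu>) (\<lambda>z. (z i, z j)). fst p \<noteq> snd p" by (subst eq)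
    from AE_distrD[OF _ this] show ?thesis by simp
  qed
  then have "AE z in ?P. i \<noteq> j \<longrightarrow> z i \<noteq> z j" for i j by (cases "i = j") auto
  then have "AE z in ?P. \<forall>i\<in>I. \<forall>j\<in>I. i \<noteq> j \<longrightarrow> z i \<noteq> z j"
    using I by (intro AE_finite_allI)
  then show ?thesis by eventually_elim (auto simp: inj_on_def)
qed

lemma sets_collision:
  assumes \<mu> [measurable_cong]: "sets \<mu> = sets borel" and I: "finite I"
  shows "{z \<in> space (PiM UNIV (\<lambda>_::'i. \<mu>)). \<not> inj_on (\<lambda>t. \<lfloor>real k * z t\<rfloor>) I} \<in> sets (PiM UNIV (\<lambda>_::'i. \<mu>))"
proof -
  have "{z \<in> space (PiM UNIV (\<lambda>_. \<mu>)). \<not> inj_on (\<lambda>t. \<lfloor>real k * z t\<rfloor>) I} =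
      (\<Union>i\<in>I. \<Union>j\<in>I - {i}. {z \<in> space (PiM UNIV (\<lambda>_. \<mu>)). \<lfloor>real k * z i\<rfloor> = \<lfloor>real k * z j\<rfloor>})"
    by (auto simp: inj_on_def)
  also have "\<dots> \<in> sets (PiM UNIV (\<lambda>_::'i. \<mu>))" using I by (intro sets.finite_UN) (auto, measurable)
  finally show ?thesis .
qed

text \<open>Almost surely the finitely many points are distinct, and then cells of length
  \<open>1/k\<close> separate them as soon as \<open>k\<close> exceeds the reciprocals of all
  gaps.\<close>

lemma collision_probability_tendsto_0:
  assumes \<mu>: "prob_space \<mu>" "sets \<mu> = sets borel" and atomless: "\<And>x :: real. emeasure \<mu> {x} = 0" and I: "finite I"
  shows "(\<lambda>k. emeasure (PiM UNIV (\<lambda>_::'i. \<mu>)) {z \<in> space (PiM UNIV (\<lambda>_. \<mu>)). \<not> inj_on (\<lambda>t. \<lfloor>real k * z t\<rfloor>) I}) \<longlonglongrightarrow> 0"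
proof -
  let ?P = "PiM UNIV (\<lambda>_::'i. \<mu>)"
  interpret P: prob_space ?P by (rule prob_space_PiM) (rule \<mu>)
  note \<mu>(2) [measurable_cong]
  define C where "C k = {z \<in> space ?P. \<not> inj_on (\<lambda>t. \<lfloor>real k * z t\<rfloor>) I}" for k :: nat
  have C [measurable]: "C k \<in> sets ?P" for k
    unfolding C_def by (rule sets_collision[OF \<mu>(2) I])
  have "(\<lambda>k. \<integral>\<^sup>+z. indicator (C k) z \<partial>?P) \<longlonglongrightarrow> (\<integral>\<^sup>+z. 0 \<partial>?P)"
  proof (rule nn_integral_dominated_convergence[where w = "\<lambda>_. 1"])
    show "AE z in ?P. (\<lambda>k. indicator (C k) z :: ennreal) \<longlonglongrightarrow> 0"
      using AE_PiM_inj_on[OF \<mu> atomless I]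
    proof eventually_elim
      case (elim z)
      have "eventually (\<lambda>k. \<lfloor>real k * z i\<rfloor> \<noteq> \<lfloor>real k * z j\<rfloor>) sequentially" if "z i \<noteq> z j" for i j
      proof -
        obtain k0 :: nat where "1 / \<bar>z i - z j\<bar> < real k0" using reals_Archimedean2 by blast
        then have "1 \<le> real k * \<bar>z i - z j\<bar>" if "k \<ge> k0" for k
          using that \<open>z i \<noteq> z j\<close> by (simp add: field_simps) (smt (verit) mult_right_mono of_nat_mono)
        then show ?thesis using floor_mult_neq eventually_sequentially by blast
      qed
      then have "eventually (\<lambda>k. \<forall>i\<in>I. \<forall>j\<in>I. i \<noteq> j \<longrightarrow> \<lfloor>real k * z i\<rfloor> \<noteq> \<lfloor>real k * z j\<rfloor>) sequentially"
        using I elim by (intro eventually_ball_finite ballI) (auto simp: inj_on_def)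
      then have "eventually (\<lambda>k. 0 = (indicator (C k) z :: ennreal)) sequentially"
      proof eventually_elim
        case (elim k)
        then have "z \<notin> C k" by (auto simp: C_def inj_on_def)
        then show ?case by simp
      qed
      then show ?case by (rule Lim_transform_eventually[OF tendsto_const])
    qed
  qed (auto simp: P.emeasure_space_1 indicator_def)
  then show ?thesis by (simp add: C_def[symmetric])
qed

section \<open>Randomly chosen cell constants\<close>

lemma distr_iid_continuous:
  assumes M: "prob_space M" and e: "iid_continuous M \<epsilon>"
  shows "\<epsilon> t \<in> borel_measurable M"
    and "distr M (PiM UNIV (\<lambda>_. borel)) (\<lambda>\<omega> t. \<epsilon> t \<omega>) = PiM UNIV (\<lambda>_. distr M borel (\<epsilon> 0))"
proof -
  interpret prob_space M by fact
  have ind: "indep_vars (\<lambda>_. borel) \<epsilon> UNIV" using e by (simp add: iid_continuous_def)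
  then have rv: "\<And>t. \<epsilon> t \<in> borel_measurable M" by (simp add: indep_vars_def)
  then show "\<epsilon> t \<in> borel_measurable M" .
  have eq: "(\<lambda>s. distr M borel (\<epsilon> s)) = (\<lambda>_. distr M borel (\<epsilon> 0))"
    using e unfolding iid_continuous_def by blast
  have "distr M (PiM UNIV (\<lambda>_. borel)) (\<lambda>\<omega>. \<lambda>t\<in>UNIV. \<epsilon> t \<omega>) = PiM UNIV (\<lambda>t. distr M borel (\<epsilon> t))"
    using indep_vars_iff_distr_eq_PiM[of UNIV \<epsilon> "\<lambda>_. borel"] ind rv by blast
  then show "distr M (PiM UNIV (\<lambda>_. borel)) (\<lambda>\<omega> t. \<epsilon> t \<omega>) = PiM UNIV (\<lambda>_. distr M borel (\<epsilon> 0))"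
    unfolding eq restrict_UNIV .
qed

text \<open>The grouping keeps the two sequences that become cell constants together and leaves the
  third, later \<open>Z\<close>, as its own factor.\<close>

lemma distr_mutually_independent_3:
  fixes e1 e2 e3 :: "int \<Rightarrow> 'w \<Rightarrow> real"
  assumes M: "prob_space M" and ind: "mutually_independent_sequences M [e1, e2, e3]"
  defines "S \<equiv> PiM UNIV (\<lambda>_::int. borel :: real measure)"
  shows "distr M ((S \<Otimes>\<^sub>M S) \<Otimes>\<^sub>M S) (\<lambda>\<omega>. ((\<lambda>t. e1 t \<omega>, \<lambda>t. e2 t \<omega>), \<lambda>t. e3 t \<omega>)) =
    (distr M S (\<lambda>\<omega> t. e1 t \<omega>) \<Otimes>\<^sub>M distr M S (\<lambda>\<omega> t. e2 t \<omega>)) \<Otimes>\<^sub>M distr M S (\<lambda>\<omega> t. e3 t \<omega>)"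
proof -
  interpret prob_space M by fact
  let ?E = "\<lambda>i \<omega> t. ([e1, e2, e3] ! i) t \<omega>"
  have iv: "indep_vars (\<lambda>_. S) ?E {..<3}"
    using ind by (simp add: mutually_independent_sequences_def S_def eval_nat_numeral)
  have "indep_var (PiM {0} (\<lambda>_. S)) (\<lambda>\<omega>. restrict (\<lambda>i. ?E i \<omega>) {0}) (PiM {1} (\<lambda>_. S)) (\<lambda>\<omega>. restrict (\<lambda>i. ?E i \<omega>) {1})"
    by (rule indep_var_restrict[OF iv]) auto
  from distr_pair_indep_var[OF this, of "\<lambda>w. w 0" S "\<lambda>w. w 1" S]
  have 1: "distr M (S \<Otimes>\<^sub>M S) (\<lambda>\<omega>. (\<lambda>t. e1 t \<omega>, \<lambda>t. e2 t \<omega>)) = distr M S (\<lambda>\<omega> t. e1 t \<omega>) \<Otimes>\<^sub>M distr M S (\<lambda>\<omega> t. e2 t \<omega>)"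
    by (simp add: measurable_component_singleton)
  have "indep_var (PiM {0, 1} (\<lambda>_. S)) (\<lambda>\<omega>. restrict (\<lambda>i. ?E i \<omega>) {0, 1}) (PiM {2} (\<lambda>_. S)) (\<lambda>\<omega>. restrict (\<lambda>i. ?E i \<omega>) {2})"
    by (rule indep_var_restrict[OF iv]) auto
  from distr_pair_indep_var[OF this, of "\<lambda>w. (w 0, w 1)" "S \<Otimes>\<^sub>M S" "\<lambda>w. w 2" S]
  show ?thesis
    by (simp add: measurable_component_singleton 1 measurable_Pair)
qed

text \<open>The three measures are the innovation laws of the alternative. A density is asked of
  \<open>\<mu>Z\<close> because the hidden models smooth \<open>X\<close> and \<open>Y\<close> but
  observe \<open>Z\<close> as it is.\<close>

locale hiding =
  fixes \<mu>X \<mu>E \<mu>Z :: "real measure" and f :: "real \<times> real \<times> real \<Rightarrow> real" and n :: nat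
  assumes prob: "prob_space \<mu>X" "prob_space \<mu>E" "prob_space \<mu>Z"
    and sets_borel [measurable_cong]: "sets \<mu>X = sets borel" "sets \<mu>E = sets borel" "sets \<mu>Z = sets borel"
    and ac_\<mu>Z: "absolutely_continuous lborel \<mu>Z"
    and f_meas: "f \<in> borel_measurable borel"
begin

definition J where "J = {1..int n}"
text \<open>Time 0 is included because the first observed \<open>Y\<close> is caused by
  \<open>X\<close> and \<open>Z\<close> at time 0.\<close>

definition I where "I = {0..int n}"

definition PX where "PX = PiM (UNIV :: int set) (\<lambda>_. \<mu>X)"
definition PE where "PE = PiM (UNIV :: int set) (\<lambda>_. \<mu>E)"
definition PZ where "PZ = PiM (UNIV :: int set) (\<lambda>_. \<mu>Z)"
definition N3 where "N3 = unif01 \<Otimes>\<^sub>M (unif01 \<Otimes>\<^sub>M unif01)"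
definition PN where "PN = PiM (UNIV :: int set) (\<lambda>_. N3)"

text \<open>One formula covers both worlds: with \<open>x\<close> and \<open>e\<close> innovation
  sequences it is the smoothed alternative, with \<open>x\<close> and \<open>e\<close> read through
  cells of \<open>z\<close> it is a hidden model. The noise stays outside \<open>f\<close>, so
  \<open>window \<delta>\<close> is a translate of \<open>window 0\<close>.\<close>

definition window :: "real \<Rightarrow> (int \<Rightarrow> real) \<Rightarrow> (int \<Rightarrow> real) \<Rightarrow> (int \<Rightarrow> real) \<Rightarrow> (int \<Rightarrow> real \<times> real \<times> real) \<Rightarrow> int \<Rightarrow> obs"
  where "window \<delta> x e z r = (\<lambda>t\<in>J. (x t + \<delta> * fst (r t), f (x (t - 1), z (t - 1), e t) + \<delta> * fst (snd (r t)), z t))"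

lemma window_cong:
  assumes "\<And>t. t \<in> I \<Longrightarrow> x t = x' t" "\<And>t. t \<in> J \<Longrightarrow> e t = e' t"
  shows "window \<delta> x e z r = window \<delta> x' e' z r"
  using assms by (auto simp: window_def fun_eq_iff I_def J_def)

lemma sets_N3: "sets N3 = sets (borel \<Otimes>\<^sub>M (borel \<Otimes>\<^sub>M borel))"
  unfolding N3_def by (intro sets_pair_measure_cong) auto

lemma window_measurable:
  assumes x: "\<And>t. t \<in> I \<Longrightarrow> (\<lambda>m. x m t) \<in> borel_measurable M"
    and e: "\<And>t. t \<in> J \<Longrightarrow> (\<lambda>m. e m t) \<in> borel_measurable M"
    and z: "\<And>t. (\<lambda>m. z m t) \<in> borel_measurable M"
    and r: "\<And>t. (\<lambda>m. r m t) \<in> M \<rightarrow>\<^sub>M N3"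
  shows "(\<lambda>m. window \<delta> (x m) (e m) (z m) (r m)) \<in> M \<rightarrow>\<^sub>M PiM J (\<lambda>_. lborel)"
  unfolding window_def
proof (rule measurable_restrict)
  fix t assume t: "t \<in> J"
  then have "t \<in> I" "t - 1 \<in> I" by (auto simp: I_def J_def)
  note [measurable] = x[OF this(1)] x[OF this(2)] e[OF t] z r
  have r' [measurable]: "(\<lambda>m. r m t) \<in> M \<rightarrow>\<^sub>M borel \<Otimes>\<^sub>M (borel \<Otimes>\<^sub>M borel)"
    using r[of t] measurable_cong_sets[OF refl sets_N3] by blast
  have "(\<lambda>m. (x m (t - 1), z m (t - 1), e m t)) \<in> borel_measurable M" by measurable
  from measurable_compose[OF this f_meas]
  have [measurable]: "(\<lambda>m. f (x m (t - 1), z m (t - 1), e m t)) \<in> borel_measurable M" .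
  show "(\<lambda>m. (x m t + \<delta> * fst (r m t), f (x m (t - 1), z m (t - 1), e m t) + \<delta> * fst (snd (r m t)), z m t)) \<in> M \<rightarrow>\<^sub>M lborel"
    by simp
qed

lemma space_borel' [simp]: "space \<mu>X = UNIV" "space \<mu>E = UNIV" "space \<mu>Z = UNIV"
  using sets_borel[THEN sets_eq_imp_space_eq] by auto

lemma prob_space_N3: "prob_space N3"
proof -
  interpret U: prob_space unif01 by (rule prob_space_unif01)
  interpret UU: pair_prob_space unif01 unif01 ..
  interpret UUU: pair_prob_space unif01 "unif01 \<Otimes>\<^sub>M unif01" ..
  show ?thesis unfolding N3_def by (rule UUU.prob_space_axioms)
qed

lemma prob_spaces: "prob_space PX" "prob_space PE" "prob_space PZ" "prob_space PN"
  unfolding PX_def PE_def PZ_def PN_def by (intro prob_space_PiM prob prob_space_N3)+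

lemma components:
  "(\<lambda>x. x t) \<in> borel_measurable PX" "(\<lambda>x. x t) \<in> borel_measurable PE" "(\<lambda>x. x t) \<in> borel_measurable PZ"
  "(\<lambda>x. x t) \<in> PN \<rightarrow>\<^sub>M N3"
  unfolding PX_def PE_def PZ_def PN_def
  using measurable_component_singleton[of t UNIV "\<lambda>_. \<mu>X"] measurable_component_singleton[of t UNIV "\<lambda>_. \<mu>E"]
    measurable_component_singleton[of t UNIV "\<lambda>_. \<mu>Z"] measurable_component_singleton[of t UNIV "\<lambda>_. N3"]
    measurable_cong_sets[OF refl sets_borel(1)] measurable_cong_sets[OF refl sets_borel(2)]
    measurable_cong_sets[OF refl sets_borel(3)] by auto

context
  fixes \<alpha> :: ennreal and B
  assumes B: "B \<in> sets (PiM J (\<lambda>_. lborel :: obs measure))"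
    and level: "\<And>Q. Q \<in> P0G \<Longrightarrow> emeasure (distr Q (PiM J (\<lambda>_. lborel)) (\<lambda>\<omega>. restrict \<omega> J)) B \<le> \<alpha>"
begin

text \<open>Here \<open>x\<close> and \<open>e\<close> are frozen and indexed by cells. Since
  \<open>X (t - 1)\<close> and the noise of \<open>Y t\<close> are both looked up in the cell of
  \<open>Z (t - 1)\<close>, the centre of \<open>Y t\<close> is a function of
  \<open>Z (t - 1)\<close>, and the window is that of a null model.\<close>

lemma hidden_le:
  fixes s :: "real \<Rightarrow> int"
  assumes \<delta>: "0 < \<delta>" and s: "s \<in> borel \<rightarrow>\<^sub>M count_space UNIV"
  shows "(\<integral>\<^sup>+q. indicator B (window \<delta> (\<lambda>t. x (s (fst q t))) (\<lambda>t. e (s (fst q (t - 1)))) (fst q) (snd q)) \<partial>(PZ \<Otimes>\<^sub>M PN)) \<le> \<alpha>"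
proof -
  note s [measurable]
  have ys [measurable]: "(\<lambda>v. y (s v)) \<in> borel_measurable borel" for y :: "int \<Rightarrow> real"
    using measurable_compose[OF s measurable_count_space] by simp
  have "(\<lambda>v. (x (s v), v, e (s v))) \<in> borel_measurable borel" by measurable
  from measurable_compose[OF this f_meas]
  have fm: "(\<lambda>v. f (x (s v), v, e (s v))) \<in> borel_measurable borel" .
  interpret H: hidden_model \<mu>Z "\<lambda>v. x (s v)" "\<lambda>v. f (x (s v), v, e (s v))" \<delta>
    by (intro hidden_model.intro prob(3) sets_borel(3) ac_\<mu>Z fm \<delta> ys)
  let ?zip = "\<lambda>(z, r) t. (z t, r t)"
  have N4: "H.N4 = \<mu>Z \<Otimes>\<^sub>M N3" by (simp add: H.N4_def N3_def)
  have \<Omega>: "H.\<Omega> = distr (PZ \<Otimes>\<^sub>M PN) H.\<Omega> ?zip"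
    unfolding H.\<Omega>_def N4 PZ_def PN_def by (rule distr_PiM_zip[OF prob(3) prob_space_N3, symmetric])
  have zip: "?zip \<in> PZ \<Otimes>\<^sub>M PN \<rightarrow>\<^sub>M H.\<Omega>"
    unfolding H.\<Omega>_def N4 PZ_def PN_def by (rule measurable_zip)
  have r [measurable]: "(\<lambda>\<omega>. restrict \<omega> J) \<in> path_space \<rightarrow>\<^sub>M PiM J (\<lambda>_. lborel)"
    unfolding path_space_def by measurable
  note [measurable] = B H.path_meas
  have "emeasure (distr H.Q (PiM J (\<lambda>_. lborel)) (\<lambda>\<omega>. restrict \<omega> J)) B
      = emeasure (distr H.\<Omega> (PiM J (\<lambda>_. lborel)) (\<lambda>\<omega>. restrict (H.path \<omega>) J)) B"
    unfolding H.Q_eq by (simp add: distr_distr comp_def)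
  also have "\<dots> = (\<integral>\<^sup>+\<omega>. indicator B (restrict (H.path \<omega>) J) \<partial>H.\<Omega>)"
  proof -
    have "(\<lambda>\<omega>. restrict (H.path \<omega>) J) \<in> H.\<Omega> \<rightarrow>\<^sub>M PiM J (\<lambda>_. lborel)"
      using measurable_compose[OF H.path_meas r] .
    then have "(\<integral>\<^sup>+w. indicator B w \<partial>distr H.\<Omega> (PiM J (\<lambda>_. lborel)) (\<lambda>\<omega>. restrict (H.path \<omega>) J)) =
        (\<integral>\<^sup>+\<omega>. indicator B (restrict (H.path \<omega>) J) \<partial>H.\<Omega>)"
      by (rule nn_integral_distr) (use B in simp)
    then show ?thesis using B by simp
  qed
  also have "\<dots> = (\<integral>\<^sup>+q. indicator B (restrict (H.path (?zip q)) J) \<partial>(PZ \<Otimes>\<^sub>M PN))"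
    by (subst \<Omega>, rule nn_integral_distr[OF zip]) measurable
  also have "\<dots> = (\<integral>\<^sup>+q. indicator B (window \<delta> (\<lambda>t. x (s (fst q t))) (\<lambda>t. e (s (fst q (t - 1)))) (fst q) (snd q)) \<partial>(PZ \<Otimes>\<^sub>M PN))"
    by (intro nn_integral_cong arg_cong[where f = "indicator B"])
      (auto simp: window_def H.path_def H.X_def H.Y_def H.Z_def fun_eq_iff case_prod_unfold)
  finally show ?thesis using level[OF H.Q_in_P0G] by simp
qed

text \<open>Fubini averages the null bounds over the constants; away from collisions this average,
  taken for a fixed \<open>Z\<close> path, coincides with the one for the alternative. The
  discrepancy is at most the collision probability.\<close>

lemma smoothed_window_le:
  assumes \<delta>: "0 < \<delta>"
  shows "(\<integral>\<^sup>+q. \<integral>\<^sup>+p. indicator B (window \<delta> (fst p) (snd p) (fst q) (snd q)) \<partial>(PX \<Otimes>\<^sub>M PE) \<partial>(PZ \<Otimes>\<^sub>M PN)) \<le> \<alpha>"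
proof -
  interpret PX: prob_space PX by (rule prob_spaces)
  interpret PE: prob_space PE by (rule prob_spaces)
  interpret PZ: prob_space PZ by (rule prob_spaces)
  interpret PN: prob_space PN by (rule prob_spaces)
  interpret XE: pair_prob_space PX PE ..
  interpret ZN: pair_prob_space PZ PN ..
  interpret XEZN: pair_prob_space "PX \<Otimes>\<^sub>M PE" "PZ \<Otimes>\<^sub>M PN" ..
  define s where "s k v = \<lfloor>real k * v\<rfloor>" for k :: nat and v :: real
  have s [measurable]: "s k \<in> borel \<rightarrow>\<^sub>M count_space UNIV" for k unfolding s_def by measurable
  define \<phi> where "\<phi> p q = (indicator B (window \<delta> (fst p) (snd p) (fst q) (snd q)) :: ennreal)" for p q
  define \<Phi> where "\<Phi> k p q = (indicator B (window \<delta> (\<lambda>t. fst p (s k (fst q t))) (\<lambda>t. snd p (s k (fst q (t - 1)))) (fst q) (snd q)) :: ennreal)" for k p q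
  define C where "C k = {z \<in> space PZ. \<not> inj_on (\<lambda>t. s k (z t)) I}" for k
  let ?M = "(PX \<Otimes>\<^sub>M PE) \<Otimes>\<^sub>M (PZ \<Otimes>\<^sub>M PN)"
  have cX: "(\<lambda>m. fst (fst m) t) \<in> borel_measurable ?M" and cE: "(\<lambda>m. snd (fst m) t) \<in> borel_measurable ?M"
    and cZ: "(\<lambda>m. fst (snd m) t) \<in> borel_measurable ?M" and cN: "(\<lambda>m. snd (snd m) t) \<in> ?M \<rightarrow>\<^sub>M N3" for t
    using components[of t] by (auto intro: measurable_compose[OF measurable_fst] measurable_compose[OF measurable_snd])
  have sm: "(\<lambda>m. s k (fst (snd m) t)) \<in> ?M \<rightarrow>\<^sub>M count_space UNIV" for k t
    using measurable_compose[OF cZ s] .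
  have \<phi>_meas: "(\<lambda>(p, q). \<phi> p q) \<in> borel_measurable ?M"
    unfolding \<phi>_def case_prod_unfold
    by (intro measurable_compose[OF _ borel_measurable_indicator[OF B]] window_measurable cX cE cZ cN)
  have \<Phi>_meas: "(\<lambda>(p, q). \<Phi> k p q) \<in> borel_measurable ?M" for k
    unfolding \<Phi>_def case_prod_unfold
    by (intro measurable_compose[OF _ borel_measurable_indicator[OF B]] window_measurable cZ cN
        measurable_compose_countable[OF cX sm] measurable_compose_countable[OF cE sm])
  have swap: "(\<integral>\<^sup>+q. \<integral>\<^sup>+p. \<Phi> k p q \<partial>(PX \<Otimes>\<^sub>M PE) \<partial>(PZ \<Otimes>\<^sub>M PN)) \<le> \<alpha>" for k
  proof -
    have "(\<integral>\<^sup>+q. \<integral>\<^sup>+p. \<Phi> k p q \<partial>(PX \<Otimes>\<^sub>M PE) \<partial>(PZ \<Otimes>\<^sub>M PN)) = (\<integral>\<^sup>+p. \<integral>\<^sup>+q. \<Phi> k p q \<partial>(PZ \<Otimes>\<^sub>M PN) \<partial>(PX \<Otimes>\<^sub>M PE))"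
      using XEZN.Fubini'[OF \<Phi>_meas] .
    also have "\<dots> \<le> (\<integral>\<^sup>+p. \<alpha> \<partial>(PX \<Otimes>\<^sub>M PE))"
      unfolding \<Phi>_def by (intro nn_integral_mono hidden_le \<delta> s)
    also have "\<dots> = \<alpha>" by (simp add: XE.emeasure_space_1)
    finally show ?thesis .
  qed
  \<comment> \<open>Reindexing is used twice: along the cells to reach the canonical finite product,
    and along the identity to return to the true innovations.\<close>
  have eq: "(\<integral>\<^sup>+p. \<Phi> k p q \<partial>(PX \<Otimes>\<^sub>M PE)) = (\<integral>\<^sup>+p. \<phi> p q \<partial>(PX \<Otimes>\<^sub>M PE))"
    if inj: "inj_on (\<lambda>t. s k (fst q t)) I" and q: "q \<in> space (PZ \<Otimes>\<^sub>M PN)" for k q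
  proof -
    define g where "g = (\<lambda>p. indicator B (window \<delta> (fst p) (snd p) (fst q) (snd q)) :: ennreal)"
    have g: "g \<in> borel_measurable (PiM I (\<lambda>_. \<mu>X) \<Otimes>\<^sub>M PiM J (\<lambda>_. \<mu>E))"
      unfolding g_def
    proof (intro measurable_compose[OF _ borel_measurable_indicator[OF B]] window_measurable)
      let ?N = "PiM I (\<lambda>_. \<mu>X) \<Otimes>\<^sub>M PiM J (\<lambda>_. \<mu>E)"
      show "(\<lambda>m. fst m t) \<in> borel_measurable ?N" if "t \<in> I" for t
        using measurable_compose[OF measurable_fst measurable_component_singleton[OF that], of "\<lambda>_. \<mu>X" "PiM J (\<lambda>_. \<mu>E)"]
          measurable_cong_sets[OF refl sets_borel(1)] by blast
      show "(\<lambda>m. snd m t) \<in> borel_measurable ?N" if "t \<in> J" for t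
        using measurable_compose[OF measurable_snd measurable_component_singleton[OF that], of "PiM I (\<lambda>_. \<mu>X)" "\<lambda>_. \<mu>E"]
          measurable_cong_sets[OF refl sets_borel(2)] by blast
      show "(\<lambda>m. snd q t) \<in> ?N \<rightarrow>\<^sub>M N3" for t
        by (intro measurable_const) (simp add: N3_def space_pair_measure)
    qed simp
    \<comment> \<open>The noise of \<open>Y t\<close> is looked up one step earlier, and shifting
      \<open>J\<close> back by one stays inside \<open>I\<close>.\<close>
    have inj': "inj_on (\<lambda>t. s k (fst q (t - 1))) J"
    proof (rule inj_onI)
      fix u v assume "u \<in> J" "v \<in> J" "s k (fst q (u - 1)) = s k (fst q (v - 1))"
      then show "u = v" using inj_onD[OF inj, of "u - 1" "v - 1"] by (simp add: I_def J_def)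
    qed
    have "(\<integral>\<^sup>+p. \<Phi> k p q \<partial>(PX \<Otimes>\<^sub>M PE)) =
        (\<integral>\<^sup>+p. g (\<lambda>t\<in>I. fst p (s k (fst q t)), \<lambda>t\<in>J. snd p (s k (fst q (t - 1)))) \<partial>(PX \<Otimes>\<^sub>M PE))"
      unfolding \<Phi>_def g_def by (intro nn_integral_cong arg_cong[where f = "indicator B"] window_cong) auto
    also have "\<dots> = (\<integral>\<^sup>+p. g p \<partial>(PiM I (\<lambda>_. \<mu>X) \<Otimes>\<^sub>M PiM J (\<lambda>_. \<mu>E)))"
      unfolding PX_def PE_def by (rule nn_integral_PiM_pair_reindex[OF prob(1,2) inj inj' g])
    also have "\<dots> = (\<integral>\<^sup>+p. g (\<lambda>t\<in>I. fst p (id t), \<lambda>t\<in>J. snd p (id t)) \<partial>(PX \<Otimes>\<^sub>M PE))"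
      unfolding PX_def PE_def by (rule nn_integral_PiM_pair_reindex[OF prob(1,2) inj_on_id inj_on_id g, symmetric])
    also have "\<dots> = (\<integral>\<^sup>+p. \<phi> p q \<partial>(PX \<Otimes>\<^sub>M PE))"
      unfolding \<phi>_def g_def by (intro nn_integral_cong arg_cong[where f = "indicator B"] window_cong) auto
    finally show ?thesis .
  qed
  have fin: "finite I" by (simp add: I_def)
  have C [measurable]: "C k \<in> sets PZ" for k
    unfolding C_def PZ_def s_def by (rule sets_collision[OF sets_borel(3) fin])
  have bound: "(\<integral>\<^sup>+q. \<integral>\<^sup>+p. \<phi> p q \<partial>(PX \<Otimes>\<^sub>M PE) \<partial>(PZ \<Otimes>\<^sub>M PN)) \<le> \<alpha> + emeasure PZ (C k)" for k
  proof -
    have "(\<integral>\<^sup>+q. \<integral>\<^sup>+p. \<phi> p q \<partial>(PX \<Otimes>\<^sub>M PE) \<partial>(PZ \<Otimes>\<^sub>M PN)) \<le>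
       (\<integral>\<^sup>+q. (\<integral>\<^sup>+p. \<Phi> k p q \<partial>(PX \<Otimes>\<^sub>M PE)) + indicator (C k) (fst q) \<partial>(PZ \<Otimes>\<^sub>M PN))"
    proof (rule nn_integral_mono)
      fix q assume q: "q \<in> space (PZ \<Otimes>\<^sub>M PN)"
      show "(\<integral>\<^sup>+p. \<phi> p q \<partial>(PX \<Otimes>\<^sub>M PE)) \<le> (\<integral>\<^sup>+p. \<Phi> k p q \<partial>(PX \<Otimes>\<^sub>M PE)) + indicator (C k) (fst q)"
      proof (cases "inj_on (\<lambda>t. s k (fst q t)) I")
        case True
        then show ?thesis using eq[OF True q] by simp
      next
        case False
        have "(\<integral>\<^sup>+p. \<phi> p q \<partial>(PX \<Otimes>\<^sub>M PE)) \<le> (\<integral>\<^sup>+p. 1 \<partial>(PX \<Otimes>\<^sub>M PE))"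
          by (intro nn_integral_mono) (simp add: \<phi>_def indicator_def)
        also have "\<dots> = 1" by (simp add: XE.emeasure_space_1)
        also have "\<dots> = indicator (C k) (fst q)" using False q by (auto simp: C_def space_pair_measure)
        finally show ?thesis by (simp add: add_increasing)
      qed
    qed
    also have "\<dots> = (\<integral>\<^sup>+q. \<integral>\<^sup>+p. \<Phi> k p q \<partial>(PX \<Otimes>\<^sub>M PE) \<partial>(PZ \<Otimes>\<^sub>M PN)) + (\<integral>\<^sup>+q. indicator (C k) (fst q) \<partial>(PZ \<Otimes>\<^sub>M PN))"
    proof (rule nn_integral_add)
      show "(\<lambda>q. \<integral>\<^sup>+p. \<Phi> k p q \<partial>(PX \<Otimes>\<^sub>M PE)) \<in> borel_measurable (PZ \<Otimes>\<^sub>M PN)"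
        using measurable_compose[OF measurable_Pair[OF measurable_snd measurable_fst] \<Phi>_meas]
        by (intro XE.P.borel_measurable_nn_integral) (simp add: case_prod_unfold)
    qed measurable
    also have "(\<integral>\<^sup>+q. indicator (C k) (fst q) \<partial>(PZ \<Otimes>\<^sub>M PN)) = emeasure PZ (C k)"
      by (subst PN.nn_integral_fst[symmetric]) (simp_all add: PN.emeasure_space_1)
    finally show ?thesis using swap[of k] by (meson add_right_mono order_trans)
  qed
  have null: "emeasure \<mu>Z {x} = 0" for x
    using absolutely_continuousD[OF ac_\<mu>Z, of "{x}"] by simp
  have "(\<lambda>k. \<alpha> + emeasure PZ (C k)) \<longlonglongrightarrow> \<alpha> + 0"
    unfolding C_def PZ_def s_def
    by (intro tendsto_add tendsto_const collision_probability_tendsto_0 prob sets_borel null fin)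
  then have "(\<integral>\<^sup>+q. \<integral>\<^sup>+p. \<phi> p q \<partial>(PX \<Otimes>\<^sub>M PE) \<partial>(PZ \<Otimes>\<^sub>M PN)) \<le> \<alpha> + 0"
    by (rule LIMSEQ_le_const) (use bound in auto)
  then show ?thesis by (simp add: \<phi>_def)
qed

end

text \<open>The law of the unsmoothed alternative on the observation times. At scale 0 the noise
  argument is multiplied away, so zeros serve as a placeholder.\<close>

definition W where
  "W = distr ((PX \<Otimes>\<^sub>M PE) \<Otimes>\<^sub>M PZ) (PiM J (\<lambda>_. lborel)) (\<lambda>m. window 0 (fst (fst m)) (snd (fst m)) (snd m) (\<lambda>_. (0, 0, 0)))"

lemma window_0_measurable:
  "(\<lambda>m. window 0 (fst (fst m)) (snd (fst m)) (snd m) (\<lambda>_. (0, 0, 0))) \<in> (PX \<Otimes>\<^sub>M PE) \<Otimes>\<^sub>M PZ \<rightarrow>\<^sub>M PiM J (\<lambda>_. lborel)"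
proof (rule window_measurable)
  show "(\<lambda>m. (0, 0, 0)) \<in> (PX \<Otimes>\<^sub>M PE) \<Otimes>\<^sub>M PZ \<rightarrow>\<^sub>M N3" for t :: int
    by (intro measurable_const) (simp add: N3_def space_pair_measure)
qed (use components in \<open>auto intro: measurable_compose[OF measurable_fst] measurable_compose[OF measurable_snd]\<close>)

lemma prob_space_W: "prob_space W"
proof -
  interpret PX: prob_space PX by (rule prob_spaces)
  interpret PE: prob_space PE by (rule prob_spaces)
  interpret PZ: prob_space PZ by (rule prob_spaces)
  interpret XE: pair_prob_space PX PE ..
  interpret XEZ: pair_prob_space "PX \<Otimes>\<^sub>M PE" PZ ..
  show ?thesis unfolding W_def by (rule XEZ.prob_space_distr[OF window_0_measurable])
qed

lemma W_le:
  assumes B: "B \<in> sets (PiM J (\<lambda>_. lborel :: obs measure))"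
    and level: "\<And>Q. Q \<in> P0G \<Longrightarrow> emeasure (distr Q (PiM J (\<lambda>_. lborel)) (\<lambda>\<omega>. restrict \<omega> J)) B \<le> \<alpha>"
    and ac: "absolutely_continuous (PiM J (\<lambda>_. lborel)) W"
  shows "emeasure W B \<le> \<alpha>"
\<comment> \<open>The third component of the displacement is 0 because \<open>Z\<close> is never
  smoothed.\<close>
proof (rule emeasure_le_of_smoothed_le[where N = "\<lambda>r t. (fst (r t), fst (snd (r t)), 0)" and R = PN, OF prob_space_W _ ac])
  fix \<delta> :: real assume \<delta>: "0 < \<delta>"
  let ?N = "\<lambda>r t. (fst (r t), fst (snd (r t)), 0 :: real)"
  interpret PX: prob_space PX by (rule prob_spaces)
  interpret PE: prob_space PE by (rule prob_spaces)
  interpret PZ: prob_space PZ by (rule prob_spaces)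
  interpret PN: prob_space PN by (rule prob_spaces)
  interpret XE: pair_prob_space PX PE ..
  interpret XEZ: pair_prob_space "PX \<Otimes>\<^sub>M PE" PZ ..
  interpret ZN: pair_prob_space PZ PN ..
  define \<psi> where "\<psi> r m = (indicator B (window \<delta> (fst (fst m)) (snd (fst m)) (snd m) r) :: ennreal)"
    for r :: "int \<Rightarrow> real \<times> real \<times> real" and m
  have c: "(\<lambda>m. fst (fst m) t) \<in> borel_measurable ((PX \<Otimes>\<^sub>M PE) \<Otimes>\<^sub>M PZ)" "(\<lambda>m. snd (fst m) t) \<in> borel_measurable ((PX \<Otimes>\<^sub>M PE) \<Otimes>\<^sub>M PZ)"
      "(\<lambda>m. snd m t) \<in> borel_measurable ((PX \<Otimes>\<^sub>M PE) \<Otimes>\<^sub>M PZ)" for t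
    using components[of t] by (auto intro: measurable_compose[OF measurable_fst] measurable_compose[OF measurable_snd])
  have \<psi>_meas: "\<psi> r \<in> borel_measurable ((PX \<Otimes>\<^sub>M PE) \<Otimes>\<^sub>M PZ)" for r
    unfolding \<psi>_def
    by (intro measurable_compose[OF _ borel_measurable_indicator[OF B]] window_measurable c measurable_const)
      (simp add: N3_def space_pair_measure)
  have "emeasure W {w \<in> space W. (\<lambda>j\<in>J. w j + \<delta> *\<^sub>R ?N r j) \<in> B} = (\<integral>\<^sup>+z. \<integral>\<^sup>+p. \<psi> r (p, z) \<partial>(PX \<Otimes>\<^sub>M PE) \<partial>PZ)" for r
  proof -
    have shift: "(\<lambda>w. \<lambda>j\<in>J. w j + \<delta> *\<^sub>R ?N r j) \<in> PiM J (\<lambda>_. lborel) \<rightarrow>\<^sub>M PiM J (\<lambda>_. lborel)"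
      by measurable
    define S where "S = {w \<in> space W. (\<lambda>j\<in>J. w j + \<delta> *\<^sub>R ?N r j) \<in> B}"
    have S: "S \<in> sets (PiM J (\<lambda>_. lborel))"
      using measurable_sets[OF shift B] by (simp add: S_def W_def vimage_def Int_def conj_commute)
    have "emeasure W S = (\<integral>\<^sup>+w. indicator S w \<partial>W)"
      using S by (intro nn_integral_indicator[symmetric]) (simp add: W_def)
    also have "\<dots> = (\<integral>\<^sup>+m. indicator S
        (window 0 (fst (fst m)) (snd (fst m)) (snd m) (\<lambda>_. (0, 0, 0))) \<partial>((PX \<Otimes>\<^sub>M PE) \<Otimes>\<^sub>M PZ))"
      unfolding W_def using S by (intro nn_integral_distr window_0_measurable borel_measurable_indicator) simp
    also have "\<dots> = (\<integral>\<^sup>+m. \<psi> r m \<partial>((PX \<Otimes>\<^sub>M PE) \<Otimes>\<^sub>M PZ))"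
    proof (rule nn_integral_cong)
      fix m assume m: "m \<in> space ((PX \<Otimes>\<^sub>M PE) \<Otimes>\<^sub>M PZ)"
      have "window 0 (fst (fst m)) (snd (fst m)) (snd m) (\<lambda>_. (0, 0, 0)) \<in> space W"
        using measurable_space[OF window_0_measurable m] by (simp add: W_def)
      moreover have "(\<lambda>j\<in>J. window 0 (fst (fst m)) (snd (fst m)) (snd m) (\<lambda>_. (0, 0, 0)) j + \<delta> *\<^sub>R ?N r j)
          = window \<delta> (fst (fst m)) (snd (fst m)) (snd m) r"
        by (auto simp: window_def fun_eq_iff)
      ultimately show "indicator S
          (window 0 (fst (fst m)) (snd (fst m)) (snd m) (\<lambda>_. (0, 0, 0))) = \<psi> r m"
        by (simp add: S_def \<psi>_def indicator_def)
    qed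
    also have "\<dots> = (\<integral>\<^sup>+z. \<integral>\<^sup>+p. \<psi> r (p, z) \<partial>(PX \<Otimes>\<^sub>M PE) \<partial>PZ)"
      using XEZ.nn_integral_snd[of "\<psi> r"] \<psi>_meas by simp
    finally show ?thesis unfolding S_def .
  qed
  then have "(\<integral>\<^sup>+r. emeasure W {w \<in> space W. (\<lambda>j\<in>J. w j + \<delta> *\<^sub>R ?N r j) \<in> B} \<partial>PN)
      = (\<integral>\<^sup>+r. \<integral>\<^sup>+z. (\<integral>\<^sup>+p. \<psi> r (p, z) \<partial>(PX \<Otimes>\<^sub>M PE)) \<partial>PZ \<partial>PN)" by simp
  \<comment> \<open>The smoothing noise, integrated last so far, joins \<open>Z\<close> in a single
    product to match \<open>smoothed_window_le\<close>.\<close>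
  also have "\<dots> = (\<integral>\<^sup>+q. (\<integral>\<^sup>+p. \<psi> (snd q) (p, fst q) \<partial>(PX \<Otimes>\<^sub>M PE)) \<partial>(PZ \<Otimes>\<^sub>M PN))"
  proof -
    let ?M = "(PZ \<Otimes>\<^sub>M PN) \<Otimes>\<^sub>M (PX \<Otimes>\<^sub>M PE)"
    have d: "(\<lambda>m. fst (snd m) t) \<in> borel_measurable ?M" "(\<lambda>m. snd (snd m) t) \<in> borel_measurable ?M"
      "(\<lambda>m. fst (fst m) t) \<in> borel_measurable ?M" "(\<lambda>m. snd (fst m) t) \<in> ?M \<rightarrow>\<^sub>M N3" for t
      using components[of t] by (auto intro: measurable_compose[OF measurable_fst] measurable_compose[OF measurable_snd])
    have "(\<lambda>(q, p). \<psi> (snd q) (p, fst q)) \<in> borel_measurable ?M"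
      unfolding \<psi>_def case_prod_unfold fst_conv snd_conv
      by (intro measurable_compose[OF _ borel_measurable_indicator[OF B]] window_measurable d)
    then have "(\<lambda>q. \<integral>\<^sup>+p. \<psi> (snd q) (p, fst q) \<partial>(PX \<Otimes>\<^sub>M PE)) \<in> borel_measurable (PZ \<Otimes>\<^sub>M PN)"
      by (rule XE.P.borel_measurable_nn_integral)
    from ZN.nn_integral_snd[OF this] show ?thesis by simp
  qed
  also have "\<dots> \<le> \<alpha>"
    using smoothed_window_le[OF B level \<delta>] by (simp add: \<psi>_def)
  finally show "(\<integral>\<^sup>+r. emeasure W {w \<in> space W. (\<lambda>j\<in>J. w j + \<delta> *\<^sub>R ?N r j) \<in> B} \<partial>PN) \<le> \<alpha>" .
next
  show "(\<lambda>r. (fst (r j), fst (snd (r j)), 0 :: real)) \<in> borel_measurable PN" for j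
  proof -
    have "(\<lambda>r. r j) \<in> PN \<rightarrow>\<^sub>M borel \<Otimes>\<^sub>M (borel \<Otimes>\<^sub>M borel)"
      using components(4)[of j] measurable_cong_sets[OF refl sets_N3] by blast
    then show ?thesis by measurable
  qed
qed (use B prob_spaces in \<open>auto simp: W_def J_def\<close>)

end

section \<open>Reduction of the test problem\<close>

lemma law_measurable:
  assumes "\<And>t. X t \<in> borel_measurable M" "\<And>t. Y t \<in> borel_measurable M" "\<And>t. Z t \<in> borel_measurable M"
  shows "(\<lambda>\<omega> t. (X t \<omega>, Y t \<omega>, Z t \<omega>)) \<in> M \<rightarrow>\<^sub>M path_space"
proof -
  have "(\<lambda>\<omega>. (X t \<omega>, Y t \<omega>, Z t \<omega>)) \<in> borel_measurable M" for t
    using assms by measurable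
  then show ?thesis unfolding path_space_def by (intro measurable_PiM_single') auto
qed

lemma restrict_path_space: "(\<lambda>\<omega>. restrict \<omega> J) \<in> path_space \<rightarrow>\<^sub>M PiM J (\<lambda>_. lborel)"
  unfolding path_space_def by measurable

lemma distr_law_restrict:
  assumes "\<And>t. X t \<in> borel_measurable M" "\<And>t. Y t \<in> borel_measurable M" "\<And>t. Z t \<in> borel_measurable M"
  shows "distr (law M X Y Z) (PiM J (\<lambda>_. lborel)) (\<lambda>\<omega>. restrict \<omega> J) =
    distr M (PiM J (\<lambda>_. lborel)) (\<lambda>\<omega>. \<lambda>t\<in>J. (X t \<omega>, Y t \<omega>, Z t \<omega>))"
  unfolding law_def using law_measurable[of X M Y Z] assms
  by (subst distr_distr[OF restrict_path_space]) (simp_all add: comp_def)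

text \<open>Absence of atoms alone would still permit a singular \<open>Z\<close>. The density comes
  from membership in \<open>\<Xi>0\<close>: a null set of \<open>Z\<close> values is a null cylinder
  in the observation space at one time.\<close>

lemma absolutely_continuous_Z_marginal:
  assumes XYZ: "\<And>t. X t \<in> borel_measurable M" "\<And>t. Y t \<in> borel_measurable M" "\<And>t. Z t \<in> borel_measurable M"
    and fdd: "fdd_absolutely_continuous (law M X Y Z)"
  shows "absolutely_continuous lborel (distr M borel (Z t))"
  unfolding absolutely_continuous_def
proof
  fix A :: "real set" assume A: "A \<in> null_sets lborel"
  interpret product_sigma_finite "\<lambda>_::int. lborel :: obs measure" by standard
  let ?L = "PiM {t} (\<lambda>_. lborel :: obs measure)" and ?N = "UNIV \<times> (UNIV \<times> A) :: obs set"
  note [measurable] = XYZ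
  have N: "?N \<in> null_sets lborel"
  proof -
    have pair: "UNIV \<times> B \<in> null_sets (lborel :: (real \<times> 'b) measure)"
      if "B \<in> null_sets lborel" for B :: "'b::euclidean_space set"
    proof -
      have "emeasure (lborel \<Otimes>\<^sub>M lborel) ((UNIV :: real set) \<times> B) = emeasure lborel (UNIV :: real set) * emeasure lborel B"
        using that by (intro lborel.emeasure_pair_measure_Times) auto
      moreover have "(UNIV :: real set) \<times> B \<in> sets (lborel \<Otimes>\<^sub>M lborel)"
        using that by (intro pair_measureI) auto
      ultimately have "(UNIV :: real set) \<times> B \<in> null_sets (lborel \<Otimes>\<^sub>M lborel)"
        using that by (intro null_setsI) (simp_all add: null_setsD1)
      then show ?thesis unfolding lborel_prod .
    qed
    show ?thesis using A by (intro pair)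
  qed
  have "emeasure ?L (PiE {t} (\<lambda>_. ?N)) = 0" using N by (subst emeasure_PiM) auto
  moreover have S: "PiE {t} (\<lambda>_. ?N) \<in> sets ?L" using N by (intro sets_PiM_I_finite) auto
  ultimately have "emeasure (distr (law M X Y Z) ?L (\<lambda>\<omega>. restrict \<omega> {t})) (PiE {t} (\<lambda>_. ?N)) = 0"
    using fdd absolutely_continuousD unfolding fdd_absolutely_continuous_def by blast
  also have "distr (law M X Y Z) ?L (\<lambda>\<omega>. restrict \<omega> {t}) = distr M ?L (\<lambda>\<omega>. \<lambda>t\<in>{t}. (X t \<omega>, Y t \<omega>, Z t \<omega>))"
    by (rule distr_law_restrict) (rule XYZ)+
  also have "emeasure \<dots> (PiE {t} (\<lambda>_. ?N)) = emeasure M ((\<lambda>\<omega>. \<lambda>t\<in>{t}. (X t \<omega>, Y t \<omega>, Z t \<omega>)) -` PiE {t} (\<lambda>_. ?N) \<inter> space M)"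
    using measurable_compose[OF law_measurable[of X M Y Z, OF XYZ] restrict_path_space, of "{t}"] S
    by (intro emeasure_distr) simp_all
  also have "(\<lambda>\<omega>. \<lambda>t\<in>{t}. (X t \<omega>, Y t \<omega>, Z t \<omega>)) -` PiE {t} (\<lambda>_. ?N) \<inter> space M = Z t -` A \<inter> space M"
    by auto
  finally show "A \<in> null_sets (distr M borel (Z t))"
    using A by (auto simp: null_sets_def emeasure_distr)
qed

text \<open>A test sees the process through its restriction to the sample times, so its rejection
  probability is the mass of one fixed region under a finite-dimensional law. The switch to
  \<open>lborel\<close> leaves the sigma-algebra unchanged and matches the format of absolute
  continuity.\<close>

lemma rejection_prob_eq:
  assumes "sets P = sets path_space" and J: "J = {1..int n}" and \<psi>: "is_test n \<psi>"
  defines "R \<equiv> {w \<in> space (PiM J (\<lambda>_. lborel :: obs measure)). \<psi> w = 1}"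
  shows "R \<in> sets (PiM J (\<lambda>_. lborel))"
    and "rejection_prob n \<psi> P = emeasure (distr P (PiM J (\<lambda>_. lborel)) (\<lambda>\<omega>. restrict \<omega> J)) R"
proof -
  have sets: "sets (PiM J (\<lambda>_. lborel :: obs measure)) = sets (PiM J (\<lambda>_. borel))" by (intro sets_PiM_cong) auto
  have sp: "space (PiM J (\<lambda>_. lborel :: obs measure)) = space (PiM J (\<lambda>_. borel))" by (rule sets_eq_imp_space_eq[OF sets])
  have "\<psi> -` {1} \<inter> space (PiM J (\<lambda>_. borel)) \<in> sets (PiM J (\<lambda>_. borel))"
    using \<psi> unfolding is_test_def J by (rule measurable_sets) simp
  also have "\<psi> -` {1} \<inter> space (PiM J (\<lambda>_. borel)) = R" unfolding R_def sp by auto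
  finally show R: "R \<in> sets (PiM J (\<lambda>_. lborel))" unfolding sets .
  have m: "(\<lambda>\<omega>. restrict \<omega> J) \<in> P \<rightarrow>\<^sub>M PiM J (\<lambda>_. lborel)"
    using restrict_path_space measurable_cong_sets[OF assms(1) refl] by blast
  have "{\<omega> \<in> space P. \<psi> (restrict \<omega> J) = 1} = (\<lambda>\<omega>. restrict \<omega> J) -` R \<inter> space P"
    using measurable_space[OF m] unfolding R_def by auto
  then show "rejection_prob n \<psi> P = emeasure (distr P (PiM J (\<lambda>_. lborel)) (\<lambda>\<omega>. restrict \<omega> J)) R"
    unfolding rejection_prob_def J[symmetric] using emeasure_distr[OF m R] by simp
qed

theorem propositionS6:
  fixes n :: nat and \<alpha> :: real and \<psi> :: "(int \<Rightarrow> obs) \<Rightarrow> nat"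
  assumes "0 < \<alpha>" and "\<alpha> < 1"
    and "is_test n \<psi>"
    and "(SUP Q\<in>P0G. rejection_prob n \<psi> Q) \<le> ennreal \<alpha>"
  shows "(SUP P\<in>A0. rejection_prob n \<psi> P) \<le> ennreal \<alpha>"
proof (rule SUP_least)
  fix P assume PA: "P \<in> A0"
  then have P0: "P \<in> \<Xi>0" unfolding A0_def by (elim CollectE conjE)
  from PA obtain M :: "sample measure" and X Y Z \<epsilon>X \<epsilon>Y \<epsilon>Z f where M: "prob_space M"
    and XYZ': "\<forall>t. X t \<in> borel_measurable M \<and> Y t \<in> borel_measurable M \<and> Z t \<in> borel_measurable M"
    and P: "P = law M X Y Z"
    and \<epsilon>: "iid_continuous M \<epsilon>X" "iid_continuous M \<epsilon>Y" "iid_continuous M \<epsilon>Z"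
    and ind: "mutually_independent_sequences M [\<epsilon>X, \<epsilon>Y, \<epsilon>Z]"
    and f: "f \<in> borel_measurable (borel :: (real \<times> real \<times> real) measure)"
    and eq: "\<forall>t. AE \<omega> in M. Z t \<omega> = \<epsilon>Z t \<omega> \<and> X t \<omega> = \<epsilon>X t \<omega> \<and> Y t \<omega> = f (X (t - 1) \<omega>, Z (t - 1) \<omega>, \<epsilon>Y t \<omega>)"
    unfolding A0_def by (elim CollectE conjE exE) (rule that; assumption)
  from XYZ' have XYZ: "X t \<in> borel_measurable M" "Y t \<in> borel_measurable M" "Z t \<in> borel_measurable M" for t
    by blast+
  interpret M: prob_space M by fact
  note iid = distr_iid_continuous[OF M \<epsilon>(1)] distr_iid_continuous[OF M \<epsilon>(2)] distr_iid_continuous[OF M \<epsilon>(3)]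
  have fdd: "fdd_absolutely_continuous P" using P0 by (simp add: \<Xi>0_def)
  have Z0: "distr M borel (\<epsilon>Z 0) = distr M borel (Z 0)"
    using eq[rule_format, of 0] by (intro distr_cong_AE iid XYZ) (auto elim!: eventually_mono)
  interpret hiding "distr M borel (\<epsilon>X 0)" "distr M borel (\<epsilon>Y 0)" "distr M borel (\<epsilon>Z 0)" f n
  proof (rule hiding.intro)
    show "absolutely_continuous lborel (distr M borel (\<epsilon>Z 0))"
      unfolding Z0 by (rule absolutely_continuous_Z_marginal[OF XYZ]) (use fdd P in simp)
  qed (simp_all add: M.prob_space_distr iid f)
  let ?S = "PiM UNIV (\<lambda>_::int. borel :: real measure)" and ?L = "PiM J (\<lambda>_. lborel :: obs measure)"
  have W: "distr P ?L (\<lambda>\<omega>. restrict \<omega> J) = W"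
  proof -
    let ?T = "\<lambda>\<omega>. ((\<lambda>t. \<epsilon>X t \<omega>, \<lambda>t. \<epsilon>Y t \<omega>), \<lambda>t. \<epsilon>Z t \<omega>)"
    have seq: "(\<lambda>\<omega> t. e t \<omega>) \<in> M \<rightarrow>\<^sub>M ?S" if "\<And>t. e t \<in> borel_measurable M" for e
      using that by (intro measurable_PiM_single') auto
    have T: "?T \<in> M \<rightarrow>\<^sub>M (?S \<Otimes>\<^sub>M ?S) \<Otimes>\<^sub>M ?S" by (intro measurable_Pair seq iid)
    have law_T: "(PX \<Otimes>\<^sub>M PE) \<Otimes>\<^sub>M PZ = distr M ((?S \<Otimes>\<^sub>M ?S) \<Otimes>\<^sub>M ?S) ?T"
      unfolding distr_mutually_independent_3[OF M ind] iid PX_def PE_def PZ_def ..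
    have win: "(\<lambda>m. window 0 (fst (fst m)) (snd (fst m)) (snd m) (\<lambda>_. (0, 0, 0))) \<in> (?S \<Otimes>\<^sub>M ?S) \<Otimes>\<^sub>M ?S \<rightarrow>\<^sub>M ?L"
      using window_0_measurable by (simp add: law_T)
    \<comment> \<open>The structural equations hold almost surely for each of countably many times,
      hence simultaneously; the sample is then a window at scale 0.\<close>
    have "AE \<omega> in M. \<forall>t. Z t \<omega> = \<epsilon>Z t \<omega> \<and> X t \<omega> = \<epsilon>X t \<omega> \<and> Y t \<omega> = f (X (t - 1) \<omega>, Z (t - 1) \<omega>, \<epsilon>Y t \<omega>)"
      using eq by (simp add: AE_all_countable)
    then have ae: "AE \<omega> in M. (\<lambda>t\<in>J. (X t \<omega>, Y t \<omega>, Z t \<omega>)) =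
        window 0 (\<lambda>t. \<epsilon>X t \<omega>) (\<lambda>t. \<epsilon>Y t \<omega>) (\<lambda>t. \<epsilon>Z t \<omega>) (\<lambda>_. (0, 0, 0))"
      by eventually_elim (simp add: window_def)
    have "distr P ?L (\<lambda>\<omega>. restrict \<omega> J) = distr M ?L (\<lambda>\<omega>. \<lambda>t\<in>J. (X t \<omega>, Y t \<omega>, Z t \<omega>))"
      unfolding P by (rule distr_law_restrict) (rule XYZ)+
    also have "\<dots> = distr M ?L (\<lambda>\<omega>. window 0 (\<lambda>t. \<epsilon>X t \<omega>) (\<lambda>t. \<epsilon>Y t \<omega>) (\<lambda>t. \<epsilon>Z t \<omega>) (\<lambda>_. (0, 0, 0)))"
    proof (rule distr_cong_AE[OF refl refl ae])
      show "(\<lambda>\<omega>. \<lambda>t\<in>J. (X t \<omega>, Y t \<omega>, Z t \<omega>)) \<in> M \<rightarrow>\<^sub>M ?L"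
        using measurable_compose[OF law_measurable[of X M Y Z, OF XYZ] restrict_path_space] by simp
      show "(\<lambda>\<omega>. window 0 (\<lambda>t. \<epsilon>X t \<omega>) (\<lambda>t. \<epsilon>Y t \<omega>) (\<lambda>t. \<epsilon>Z t \<omega>) (\<lambda>_. (0, 0, 0))) \<in> M \<rightarrow>\<^sub>M ?L"
        using measurable_compose[OF T win] by simp
    qed
    also have "\<dots> = W"
      unfolding W_def law_T by (subst distr_distr[OF win T]) (simp add: comp_def)
    finally show ?thesis .
  qed
  define R where "R = {w \<in> space ?L. \<psi> w = 1}"
  note rejection = rejection_prob_eq[OF _ J_def assms(3), folded R_def]
  have sets_path: "sets Q = sets path_space" if "Q \<in> \<Xi>0" for Q
    using that by (auto simp: \<Xi>0_def law_def)
  have "emeasure W R \<le> ennreal \<alpha>"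
  proof (rule W_le)
    show "R \<in> sets ?L" by (rule rejection(1)[OF sets_path[OF P0]])
    \<comment> \<open>\<open>W\<close> is the finite-dimensional law of \<open>P\<close> at the
      sample times, so this is one instance of the absolute continuity built into
      \<open>\<Xi>0\<close>.\<close>
    show "absolutely_continuous ?L W"
      using fdd W unfolding fdd_absolutely_continuous_def by (metis J_def finite_atLeastAtMost_int)
    fix Q assume Q: "Q \<in> P0G"
    then have "Q \<in> \<Xi>0" by (simp add: P0G_def)
    then have "emeasure (distr Q ?L (\<lambda>\<omega>. restrict \<omega> J)) R = rejection_prob n \<psi> Q"
      by (intro rejection(2)[symmetric] sets_path)
    also have "\<dots> \<le> ennreal \<alpha>" using SUP_upper[OF Q, of "rejection_prob n \<psi>"] assms(4) by (rule order_trans)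
    finally show "emeasure (distr Q ?L (\<lambda>\<omega>. restrict \<omega> J)) R \<le> ennreal \<alpha>" .
  qed
  then show "rejection_prob n \<psi> P \<le> ennreal \<alpha>"
    using rejection(2)[OF sets_path[OF P0]] W by simp
qed

end
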